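(* If $(Q,\mathfrak m_Q,\mathsf k)$ is a compressed Gorenstein Artin local ring with $\ell\ell(Q)\geq 4$, then $Q$ is indecomposable as a connected sum over $\mathsf k$.
   Context: $\ell\ell(T)=\max\{n:\mathfrak m_T^n\neq 0\}$ is the Loewy length of an Artinian local ring $T$. The Hilbert function of $(Q,\mathfrak m_Q,\mathsf k)$ is $H_Q(i)=\dim_{\mathsf k}(\mathfrak m_Q^i/\mathfrak m_Q^{i+1})$. A Gorenstein Artin local ring $Q$ with embedding dimension $d$ and Loewy length $s$ is compressed if it has the maximum possible Hilbert function given $d$ and $s$, i.e. $H_Q(i)=\min\left\{\binom{d+i-1}{i},\binom{d+s-i-1}{s-i}\right\}$ for $0\le i\le s$. Fibre product: for local rings $(R,\mathfrak m_R,\mathsf k)$, $(S,\mathfrak m_S,\mathsf k)$ with natural projections $\pi_R,\pi_S$ onto $\mathsf k$, $R\times_{\mathsf k}S=\{(r,s)\in R\times S:\pi_R(r)=\pi_S(s)\}$. Connected sum: if $R,S$ are Gorenstein Artin local rings with residue field $\mathsf k$, different from $\mathsf k$, and $\operatorname{soc}(R)=\langle\delta_R\rangle$, $\operatorname{soc}(S)=\langle\delta_S\rangle$, then $R\#_{\mathsf k}S=(R\times_{\mathsf k}S)/\langle(\delta_R,0)-(0,\delta_S)\rangle$. It depends on the chosen socle generators; $Q\simeq R\#_{\mathsf k}S$ means that this holds for some choice. A Gorenstein Artin local ring $(Q,\mathfrak m_Q,\mathsf k)$ decomposes (non-trivially) as a connected sum over $\mathsf k$ if there are Gorenstein Artin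 local rings $R,S$ with residue field $\mathsf k$ and $\ell\ell(R),\ell\ell(S)\ge 2$ such that $Q\simeq R\#_{\mathsf k}S$ and $R\not\simeq Q\not\simeq S$ (the last condition is automatic by length). Otherwise $Q$ is indecomposable as a connected sum over $\mathsf k$. *)

theory Defs
  imports
    "HOL-Algebra.Ideal_Product"
    "HOL-Algebra.Chinese_Remainder"
    "Jordan_Normal_Form.Missing_VectorSpace"
begin

locale local_ring = cring R for R (structure) +
  assumes unique_maximal: "\<exists>!M. maximalideal M R"

definition max_ideal :: "('a, 'm) ring_scheme \<Rightarrow> 'a set"
  where "max_ideal R = (THE M. maximalideal M R)"

locale artin_local_ring = local_ring R for R (structure) +
  assumes descending_chains:
    "\<lbrakk>\<And>n::nat. ideal (I n) R; \<And>n. I (Suc n) \<subseteq> I n\<rbrakk> \<Longrightarrow> \<exists>n. \<forall>m\<ge>n. I m = I n"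

primrec ideal_power :: "('a, 'm) ring_scheme \<Rightarrow> 'a set \<Rightarrow> nat \<Rightarrow> 'a set"
  where
    "ideal_power R I 0 = carrier R"
  | "ideal_power R I (Suc n) = ideal_prod R I (ideal_power R I n)"

text \<open>The maximum is taken over a nonempty finite set, since the maximal ideal
  of an Artinian local ring is nilpotent.\<close>
definition loewy_length :: "('a, 'm) ring_scheme \<Rightarrow> nat"
  where "loewy_length R = Max {n. ideal_power R (max_ideal R) n \<noteq> {\<zero>\<^bsub>R\<^esub>}}"

text \<open>The quotient \<open>I/J\<close> as a vector space over the residue field, for ideals
  \<open>J \<subseteq> I\<close> with \<open>\<mm> I \<subseteq> J\<close>, where \<open>\<mm>\<close> is the maximal ideal. Vectors are cosets of \<open>J\<close>
  and scalars are cosets of \<open>\<mm>\<close>; \<open>rcoset_mult\<close> with modulus \<open>J\<close> sends the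
  cosets of \<open>a\<close> and \<open>x\<close> to the coset \<open>J + a x\<close>, also when the first one is a
  coset of \<open>\<mm>\<close>. The fields \<open>mult\<close> and \<open>one\<close> play no role for a module record.\<close>
definition residue_space :: "('a, 'm) ring_scheme \<Rightarrow> 'a set \<Rightarrow> 'a set \<Rightarrow> ('a set, 'a set) module"
  where "residue_space R I J =
    \<lparr>carrier = {J +>\<^bsub>R\<^esub> x |x. x \<in> I}, mult = rcoset_mult R J, one = J +>\<^bsub>R\<^esub> \<one>\<^bsub>R\<^esub>,
     zero = J, add = set_add R, smult = rcoset_mult R J\<rparr>"

lemma (in local_ring) maximalideal_max_ideal: "maximalideal (max_ideal R) R"
  unfolding max_ideal_def using unique_maximal by (rule theI')

lemma (in local_ring) residue_smult:
  assumes I: "ideal I R" and J: "ideal J R"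
    and mI: "ideal_prod R (max_ideal R) I \<subseteq> J"
    and a: "a \<in> carrier R" and x: "x \<in> I"
  shows "rcoset_mult R J (max_ideal R +> a) (J +> x) = J +> (a \<otimes> x)"
proof -
  interpret M: maximalideal "max_ideal R" R by (rule maximalideal_max_ideal)
  interpret I: ideal I R by (rule I)
  interpret J: ideal J R by (rule J)
  have xc: "x \<in> carrier R" using x I.Icarr by blast
  have eq: "J +> (a' \<otimes> x') = J +> (a \<otimes> x)"
    if a': "a' \<in> max_ideal R +> a" and x': "x' \<in> J +> x" for a' x'
  proof -
    obtain h where h: "h \<in> max_ideal R" "a' = h \<oplus> a" using a' unfolding a_r_coset_def' by blast
    obtain j where j: "j \<in> J" "x' = j \<oplus> x" using x' unfolding a_r_coset_def' by blast
    have hc: "h \<in> carrier R" "j \<in> carrier R" using h j by (auto simp: M.Icarr J.Icarr)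
    have "h \<otimes> x \<in> J" using mI h x by (blast intro: ideal_prod.prod)
    moreover have "h \<otimes> j \<in> J" "a \<otimes> j \<in> J" using j hc a by (auto intro: J.I_l_closed)
    ultimately have 1: "h \<otimes> j \<oplus> a \<otimes> j \<oplus> h \<otimes> x \<in> J" by (intro J.a_closed)
    have "a' \<otimes> x' = (h \<otimes> j \<oplus> a \<otimes> j \<oplus> h \<otimes> x) \<oplus> a \<otimes> x"
      unfolding h j using hc a xc by algebra
    then have "a' \<otimes> x' \<in> J +> (a \<otimes> x)" using 1 unfolding a_r_coset_def' by blast
    then have "J +> (a \<otimes> x) = J +> (a' \<otimes> x')"
      by (rule J.a_repr_independence') (use a xc in simp)
    then show ?thesis by (rule sym)
  qed
  have "a \<in> max_ideal R +> a" "x \<in> J +> x" using a xc M.a_rcos_self J.a_rcos_self by auto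
  then have "(\<Union>a'\<in>max_ideal R +> a. \<Union>x'\<in>J +> x. J +> (a' \<otimes> x')) = J +> (a \<otimes> x)"
    using eq by (intro equalityI subsetI) fast+
  then show ?thesis unfolding rcoset_mult_def .
qed

lemma (in local_ring) vectorspace_residue_space:
  assumes I: "ideal I R" and J: "ideal J R"
    and mI: "ideal_prod R (max_ideal R) I \<subseteq> J"
  shows "vectorspace (R Quot max_ideal R) (residue_space R I J)"
proof -
  interpret M: maximalideal "max_ideal R" R by (rule maximalideal_max_ideal)
  interpret I: ideal I R by (rule I)
  interpret J: ideal J R by (rule J)
  have F: "field (R Quot max_ideal R)" by (rule M.quotient_is_field) (rule is_cring)
  interpret F: field "R Quot max_ideal R" by (rule F)
  note sm = residue_smult[OF I J mI]
  have add: "set_add R (J +> x) (J +> y) = J +> (x \<oplus> y)" if "x \<in> I" "y \<in> I" for x y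
    using that by (intro J.a_rcos_sum I.Icarr)
  have J0: "J = J +> \<zero>" using J.a_subset by auto
  let ?V = "residue_space R I J"
  have cV: "X \<in> carrier ?V \<longleftrightarrow> (\<exists>x\<in>I. X = J +> x)" for X
    unfolding residue_space_def by auto
  have aV: "add ?V (J +> x) (J +> y) = J +> (x \<oplus> y)" if "x \<in> I" "y \<in> I" for x y
    using add[OF that] unfolding residue_space_def by simp
  have zV: "zero ?V = J +> \<zero>" using J0 unfolding residue_space_def by simp
  have ag: "abelian_group ?V"
  proof (rule abelian_groupI)
    fix X Y assume "X \<in> carrier ?V" "Y \<in> carrier ?V"
    then obtain x y where *: "x \<in> I" "y \<in> I" "X = J +> x" "Y = J +> y" unfolding cV by blast
    show "add ?V X Y \<in> carrier ?V" unfolding cV * aV[OF *(1,2)] using I.a_closed[OF *(1,2)] by blast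
    show "add ?V X Y = add ?V Y X" unfolding *(3,4) using *(1,2) by (simp add: aV a_comm I.Icarr)
  next
    show "zero ?V \<in> carrier ?V" unfolding cV zV using I.zero_closed by blast
  next
    fix X Y Z assume "X \<in> carrier ?V" "Y \<in> carrier ?V" "Z \<in> carrier ?V"
    then obtain x y z where *: "x \<in> I" "y \<in> I" "z \<in> I" "X = J +> x" "Y = J +> y" "Z = J +> z"
      unfolding cV by blast
    show "add ?V (add ?V X Y) Z = add ?V X (add ?V Y Z)"
      unfolding * using * by (simp add: aV I.a_closed I.Icarr a_assoc)
  next
    fix X assume "X \<in> carrier ?V"
    then obtain x where *: "x \<in> I" "X = J +> x" unfolding cV by blast
    show "add ?V (zero ?V) X = X" unfolding zV * using * by (simp add: aV I.zero_closed I.Icarr)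
    have "add ?V (J +> (\<ominus> x)) X = zero ?V"
      unfolding zV * using * by (simp add: aV I.a_inv_closed I.Icarr l_neg)
    moreover have "J +> (\<ominus> x) \<in> carrier ?V" unfolding cV using I.a_inv_closed[OF *(1)] by blast
    ultimately show "\<exists>Y \<in> carrier ?V. add ?V Y X = zero ?V" by (rule bexI)
  qed
  have fc: "carrier (R Quot max_ideal R) = {max_ideal R +> a |a. a \<in> carrier R}"
    unfolding FactRing_def A_RCOSETS_def' by auto
  have fm: "mult (R Quot max_ideal R) (max_ideal R +> a) (max_ideal R +> b) = max_ideal R +> (a \<otimes> b)"
    if "a \<in> carrier R" "b \<in> carrier R" for a b
    using that by (simp add: FactRing_def M.rcoset_mult_add)
  have fa: "add (R Quot max_ideal R) (max_ideal R +> a) (max_ideal R +> b) = max_ideal R +> (a \<oplus> b)"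
    if "a \<in> carrier R" "b \<in> carrier R" for a b
    using that by (simp add: FactRing_def M.a_rcos_sum)
  have f1: "one (R Quot max_ideal R) = max_ideal R +> \<one>" by (simp add: FactRing_def)
  have cF: "A \<in> carrier (R Quot max_ideal R) \<longleftrightarrow> (\<exists>a\<in>carrier R. A = max_ideal R +> a)" for A
    unfolding fc by auto
  have smV: "smult ?V (max_ideal R +> a) (J +> x) = J +> (a \<otimes> x)" if "a \<in> carrier R" "x \<in> I" for a x
    using sm[OF that] unfolding residue_space_def by simp
  note simps = aV smV fm fa I.I_l_closed I.Icarr I.a_closed l_distr r_distr m_assoc
  have "module (R Quot max_ideal R) ?V"
  proof (rule moduleI)
    show "cring (R Quot max_ideal R)" by (rule F.is_cring)
    show "abelian_group ?V" by (rule ag)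
  next
    fix A X assume "A \<in> carrier (R Quot max_ideal R)" "X \<in> carrier ?V"
    then obtain a x where *: "a \<in> carrier R" "x \<in> I" "A = max_ideal R +> a" "X = J +> x"
      unfolding cF cV by blast
    show "smult ?V A X \<in> carrier ?V" unfolding cV * smV[OF *(1,2)] using I.I_l_closed[OF *(2,1)] by blast
  next
    fix A B X assume "A \<in> carrier (R Quot max_ideal R)" "B \<in> carrier (R Quot max_ideal R)" "X \<in> carrier ?V"
    then obtain a b x where *: "a \<in> carrier R" "b \<in> carrier R" "x \<in> I"
      "A = max_ideal R +> a" "B = max_ideal R +> b" "X = J +> x"
      unfolding cF cV by blast
    show "smult ?V (A \<oplus>\<^bsub>R Quot max_ideal R\<^esub> B) X = smult ?V A X \<oplus>\<^bsub>?V\<^esub> smult ?V B X"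
      unfolding * using * by (simp add: simps)
    show "smult ?V (A \<otimes>\<^bsub>R Quot max_ideal R\<^esub> B) X = smult ?V A (smult ?V B X)"
      unfolding * using * by (simp add: simps)
  next
    fix A X Y assume "A \<in> carrier (R Quot max_ideal R)" "X \<in> carrier ?V" "Y \<in> carrier ?V"
    then obtain a x y where *: "a \<in> carrier R" "x \<in> I" "y \<in> I"
      "A = max_ideal R +> a" "X = J +> x" "Y = J +> y"
      unfolding cF cV by blast
    show "smult ?V A (X \<oplus>\<^bsub>?V\<^esub> Y) = smult ?V A X \<oplus>\<^bsub>?V\<^esub> smult ?V A Y"
      unfolding * using * by (simp add: simps)
  next
    fix X assume "X \<in> carrier ?V"
    then obtain x where *: "x \<in> I" "X = J +> x" unfolding cV by blast
    show "smult ?V \<one>\<^bsub>R Quot max_ideal R\<^esub> X = X"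
      unfolding f1 * using * by (simp add: simps)
  qed
  then show ?thesis using F by (simp add: vectorspace_def)
qed

definition residue_dim :: "('a, 'm) ring_scheme \<Rightarrow> 'a set \<Rightarrow> 'a set \<Rightarrow> nat"
  where "residue_dim R I J = vectorspace.dim (R Quot max_ideal R) (residue_space R I J)"

definition hilbert_function :: "('a, 'm) ring_scheme \<Rightarrow> nat \<Rightarrow> nat"
  where "hilbert_function R i =
    residue_dim R (ideal_power R (max_ideal R) i) (ideal_power R (max_ideal R) (Suc i))"

definition embedding_dim :: "('a, 'm) ring_scheme \<Rightarrow> nat"
  where "embedding_dim R = hilbert_function R 1"

definition socle :: "('a, 'm) ring_scheme \<Rightarrow> 'a set"
  where "socle R = {x \<in> carrier R. \<forall>y \<in> max_ideal R. y \<otimes>\<^bsub>R\<^esub> x = \<zero>\<^bsub>R\<^esub>}"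

text \<open>An Artinian local ring is Gorenstein iff its type, the dimension of its socle
  over the residue field, is one.\<close>
locale gorenstein_artin_local_ring = artin_local_ring R for R (structure) +
  assumes type_one: "residue_dim R (socle R) {\<zero>} = 1"

text \<open>Truncated subtraction is harmless: \<open>d + i - 1\<close> truncates only for \<open>d = i = 0\<close>,
  where the coefficient is the required \<open>1\<close>, and similarly for the second one.\<close>
definition compressed :: "('a, 'm) ring_scheme \<Rightarrow> bool"
  where "compressed Q \<longleftrightarrow>
    (let d = embedding_dim Q; s = loewy_length Q in
      \<forall>i\<le>s. hilbert_function Q i =
        min ((d + i - 1) choose i) ((d + s - i - 1) choose (s - i)))"

text \<open>A projection of a local ring onto \<open>k\<close> identifies its residue field with \<open>k\<close>.\<close>
definition residue_projection ::
    "('a, 'm) ring_scheme \<Rightarrow> ('k, 'n) ring_scheme \<Rightarrow> ('a \<Rightarrow> 'k) \<Rightarrow> bool"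
  where "residue_projection R k \<pi> \<longleftrightarrow>
    local_ring R \<and> field k \<and> \<pi> \<in> ring_hom R k \<and> \<pi> ` carrier R = carrier k \<and>
    a_kernel R k \<pi> = max_ideal R"

definition fibre_product ::
    "('a, 'm) ring_scheme \<Rightarrow> ('b, 'n) ring_scheme \<Rightarrow> ('a \<Rightarrow> 'k) \<Rightarrow> ('b \<Rightarrow> 'k) \<Rightarrow> ('a \<times> 'b) ring"
  where "fibre_product R S \<pi>\<^sub>R \<pi>\<^sub>S =
    (RDirProd R S)\<lparr>carrier := {(r, s). r \<in> carrier R \<and> s \<in> carrier S \<and> \<pi>\<^sub>R r = \<pi>\<^sub>S s}\<rparr>"

definition connected_sum ::
    "('a, 'm) ring_scheme \<Rightarrow> ('b, 'n) ring_scheme \<Rightarrow> ('a \<Rightarrow> 'k) \<Rightarrow> ('b \<Rightarrow> 'k) \<Rightarrow> 'a \<Rightarrow> 'b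
      \<Rightarrow> ('a \<times> 'b) set ring"
  where "connected_sum R S \<pi>\<^sub>R \<pi>\<^sub>S \<delta>\<^sub>R \<delta>\<^sub>S =
    (let P = fibre_product R S \<pi>\<^sub>R \<pi>\<^sub>S
     in P Quot (PIdl\<^bsub>P\<^esub> ((\<delta>\<^sub>R, \<zero>\<^bsub>S\<^esub>) \<ominus>\<^bsub>P\<^esub> (\<zero>\<^bsub>R\<^esub>, \<delta>\<^sub>S))))"

definition decomposes_as_connected_sum ::
    "('q, 'm) ring_scheme \<Rightarrow> ('k, 'n) ring_scheme \<Rightarrow> 'r ring \<Rightarrow> 's ring \<Rightarrow> bool"
  where "decomposes_as_connected_sum Q k R S \<longleftrightarrow>
    gorenstein_artin_local_ring R \<and> gorenstein_artin_local_ring S \<and>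
    loewy_length R \<ge> 2 \<and> loewy_length S \<ge> 2 \<and>
    (\<exists>\<pi>\<^sub>R \<pi>\<^sub>S. residue_projection R k \<pi>\<^sub>R \<and> residue_projection S k \<pi>\<^sub>S \<and>
      (\<exists>\<delta>\<^sub>R \<in> carrier R. \<exists>\<delta>\<^sub>S \<in> carrier S.
        socle R = PIdl\<^bsub>R\<^esub> \<delta>\<^sub>R \<and> socle S = PIdl\<^bsub>S\<^esub> \<delta>\<^sub>S \<and>
        Q \<simeq> connected_sum R S \<pi>\<^sub>R \<pi>\<^sub>S \<delta>\<^sub>R \<delta>\<^sub>S)) \<and>
    \<not> R \<simeq> Q \<and> \<not> Q \<simeq> S"

text \<open>HOL cannot quantify over types inside a formula, so the element types of the
  two summands are parameters; in a theorem they are arbitrary type variables.\<close>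
definition indecomposable_as_connected_sum ::
    "'r itself \<Rightarrow> 's itself \<Rightarrow> ('q, 'm) ring_scheme \<Rightarrow> ('k, 'n) ring_scheme \<Rightarrow> bool"
  where "indecomposable_as_connected_sum _ _ Q k \<longleftrightarrow>
    \<not> (\<exists>(R :: 'r ring) (S :: 's ring). decomposes_as_connected_sum Q k R S)"

end

theory Submission
  imports "HOL-Algebra.Ring_Divisibility" Defs
begin

text \<open>Let \<open>\<mm>\<close> be the maximal ideal of \<open>Q\<close>, let \<open>d\<close> be its embedding dimension and \<open>s\<close> its Loewy
  length. The statement is decided in degree two. For \<open>s \<ge> 4\<close> the value of the Hilbert function
  prescribed for a compressed ring in degree \<open>2\<close> is the full number of quadratic monomials in \<open>d\<close>
  variables, because the socle side of the minimum is at least as large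
  (\<open>compressed_hilbert_function_2\<close>). In other words, minimal generators of \<open>\<mm>\<close> satisfy no quadratic
  relation modulo \<open>\<mm>\<^sup>3\<close>, so the associated graded ring looks like a polynomial ring up to degree two.
  A polynomial ring is a domain, hence two elements outside \<open>\<mm>\<^sup>2\<close> cannot have a product in \<open>\<mm>\<^sup>3\<close>.

  A connected sum violates this. It splits the maximal ideal as \<open>\<mm> = A + B\<close> with \<open>A B = 0\<close>, where
  \<open>A\<close> and \<open>B\<close> are the images of the maximal ideals of the two summands
  (\<open>connected_sum_splitting\<close>). So one of the two parts, say \<open>A\<close>, lies in \<open>\<mm>\<^sup>2\<close>. For \<open>a \<in> A\<close> this gives
  \<open>a \<mm> = a A \<subseteq> a \<mm>\<^sup>2\<close>, and since \<open>\<mm>\<close> is nilpotent, \<open>a \<mm> = 0\<close>; thus \<open>A\<^sup>2 = 0\<close>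
  (\<open>orthogonal_splitting_trivial\<close>). But the only relation imposed by a connected sum identifies the
  two socles, so the maximal ideals of the summands embed into \<open>Q\<close>, and both have nonzero square
  because both Loewy lengths are at least two.

  The domain property is obtained by counting rather than through the associated graded ring
  (\<open>hilbert_function_2_less\<close>): if \<open>a, b \<in> \<mm> - \<mm>\<^sup>2\<close> and \<open>a b \<in> \<mm>\<^sup>3\<close>, complete \<open>a\<close> by a set \<open>X\<close>, and
  \<open>b\<close> by a set \<open>Y\<close>, to generators of \<open>\<mm>\<close> modulo \<open>\<mm>\<^sup>2\<close>, both with at most \<open>d - 1\<close> elements. Then \<open>\<mm>\<^sup>2\<close> is generated
  modulo \<open>\<mm>\<^sup>3\<close> by the products \<open>a y\<close> for \<open>y \<in> Y\<close> and the products of two elements of \<open>X\<close>, which are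
  at least one too few.

  The dimension of a vector space carries information only if the space is finite dimensional. For
  \<open>\<mm>/\<mm>\<^sup>2\<close> this follows from the descending chain condition on ideals
  (\<open>fin_dim_if_descending_chains\<close>), as does the nilpotency of \<open>\<mm>\<close> (\<open>max_ideal_nilpotent\<close>).\<close>

section \<open>Finite dimension from descending chains\<close>

text \<open>In an infinite-dimensional space choose vectors \<open>f 0, f 1, \<dots>\<close>, each outside the span of its
  predecessors. They are independent, so the spans of the tails \<open>f n, f (n + 1), \<dots>\<close> form a strictly
  descending chain.\<close>
lemma (in vectorspace) fin_dim_if_descending_chains:
  assumes dcc: "\<And>W :: nat \<Rightarrow> 'c set. \<lbrakk>\<And>n. submodule K (W n) V; \<And>n. W (Suc n) \<subseteq> W n\<rbrakk>
    \<Longrightarrow> \<exists>n. W (Suc n) = W n"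
  shows fin_dim
proof (rule ccontr)
  assume nf: "\<not> fin_dim"
  have ex: "\<exists>v \<in> carrier V. v \<notin> span A" if "finite A" "A \<subseteq> carrier V" for A
    using nf that span_is_subset2[OF that(2)] unfolding fin_dim_def by blast
  define h where "h A = (SOME v. v \<in> carrier V \<and> v \<notin> span A)" for A
  have h: "h A \<in> carrier V" "h A \<notin> span A" if "finite A" "A \<subseteq> carrier V" for A
    using someI_ex[of "\<lambda>v. v \<in> carrier V \<and> v \<notin> span A"] ex[OF that] unfolding h_def by blast+
  define F where "F = rec_nat {} (\<lambda>_ A. insert (h A) A)"
  have F0: "F 0 = {}" and FS: "F (Suc n) = insert (h (F n)) (F n)" for n
    by (simp_all add: F_def)
  define f where "f n = h (F n)" for n
  have F: "finite (F n) \<and> F n \<subseteq> carrier V" for n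
    by (induction n) (auto simp: F0 FS h(1))
  have Ff: "F n = f ` {..<n}" for n
    by (induction n) (auto simp: F0 FS f_def lessThan_Suc)
  have fc: "f n \<in> carrier V" and fn: "f n \<notin> span (f ` {..<n})" for n
    using h[of "F n"] F[of n] by (simp_all add: f_def flip: Ff[unfolded f_def])
  have inj: "inj f"
  proof (rule linorder_injI)
    fix i j :: nat assume "i < j"
    then have "f i \<in> span (f ` {..<j})"
      using fc by (intro span_mem) auto
    then show "f i \<noteq> f j" using fn[of j] by metis
  qed
  have li: "lin_indpt (f ` {..<n})" for n
  proof (induction n)
    case 0 then show ?case by (simp add: lin_dep_def)
  next
    case (Suc n)
    have "f n \<notin> f ` {..<n}" using inj by (auto dest: injD)
    then have "lin_indpt (f ` {..<n} \<union> {f n})"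
      using lin_dep_iff_in_span[of "f ` {..<n}" "f n"] Suc fc fn by auto
    then show ?case by (simp add: lessThan_Suc)
  qed
  have li_range: "lin_indpt (range f)"
  proof
    assume "lin_dep (range f)"
    then obtain A a v where A: "finite A" "A \<subseteq> range f" "a \<in> A \<rightarrow> carrier K" "lincomb a A = \<zero>\<^bsub>V\<^esub>"
      "v \<in> A" "a v \<noteq> \<zero>\<^bsub>K\<^esub>" unfolding lin_dep_def by blast
    obtain N where N: "finite N" "A = f ` N" using finite_subset_image[OF A(1,2)] by blast
    obtain n where "N \<subseteq> {..<n}" using N(1) unfolding finite_nat_set_iff_bounded by blast
    then have "A \<subseteq> f ` {..<n}" using N by blast
    then have "lin_dep (f ` {..<n})" by (rule lin_dep_crit[OF A(1) _ A(3,5,6,4)])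
    then show False using li by blast
  qed
  define W where "W n = span (f ` {n..})" for n
  have "\<exists>n. W (Suc n) = W n"
  proof (rule dcc)
    show "submodule K (W n) V" for n unfolding W_def using fc by (intro span_is_submodule) auto
    show "W (Suc n) \<subseteq> W n" for n unfolding W_def by (intro span_is_monotone image_mono) auto
  qed
  then obtain n where "W (Suc n) = W n" by blast
  moreover have "f n \<in> W n" unfolding W_def using fc by (intro span_mem) auto
  ultimately have "f n \<in> span (f ` {Suc n..})" unfolding W_def by simp
  moreover have "f n \<notin> f ` {Suc n..}" using inj by (auto dest: injD)
  moreover have "lin_indpt (f ` {Suc n..})"
    by (rule subset_li_is_li[OF li_range]) auto
  ultimately have "lin_dep (f ` {Suc n..} \<union> {f n})"
    using lin_dep_iff_in_span[of "f ` {Suc n..}" "f n"] fc by blast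
  then show False using subset_li_is_li[OF li_range, of "f ` {Suc n..} \<union> {f n}"] by blast
qed

section \<open>Ideals generating a quotient, and dimension over the residue field\<close>

lemma (in local_ring) ideal_max_ideal: "ideal (max_ideal R) R"
  using maximalideal_max_ideal by (simp add: maximalideal_def)

lemma (in cring) ideal_ideal_power: "ideal I R \<Longrightarrow> ideal (ideal_power R I n) R"
  by (induction n) (auto intro: oneideal ideal_prod_is_ideal)

text \<open>The vector space \<open>I/J\<close> over the residue field. Its subspaces correspond to the ideals between \<open>J\<close>
  and \<open>I\<close>, so spanning statements about \<open>I/J\<close> can be read as statements about ideals of the form
  \<open>Idl (X \<union> J)\<close>.\<close>
locale residue_quotient = local_ring R for R (structure) +
  fixes I J
  assumes I: "ideal I R" and J: "ideal J R" and JI: "J \<subseteq> I"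
    and mI: "ideal_prod R (max_ideal R) I \<subseteq> J"
begin

sublocale I: ideal I R by (rule I)
sublocale J: ideal J R by (rule J)
sublocale V: vectorspace "R Quot max_ideal R" "residue_space R I J"
  by (rule vectorspace_residue_space[OF I J mI])

lemma carrier_residue_space: "carrier (residue_space R I J) = {J +> x |x. x \<in> I}"
  by (simp add: residue_space_def)

lemma add_residue_space:
  assumes "x \<in> I" "y \<in> I"
  shows "(J +> x) \<oplus>\<^bsub>residue_space R I J\<^esub> (J +> y) = J +> (x \<oplus> y)"
  using J.a_rcos_sum[of x y] assms by (simp add: residue_space_def I.Icarr)

lemma smult_residue_space:
  assumes "a \<in> carrier R" "x \<in> I"
  shows "(max_ideal R +> a) \<odot>\<^bsub>residue_space R I J\<^esub> (J +> x) = J +> (a \<otimes> x)"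
  using residue_smult[OF I J mI assms] by (simp add: residue_space_def)

lemma zero_residue_space: "\<zero>\<^bsub>residue_space R I J\<^esub> = J"
  by (simp add: residue_space_def)

lemma carrier_residue_field: "carrier (R Quot max_ideal R) = {max_ideal R +> a |a. a \<in> carrier R}"
  unfolding FactRing_def A_RCOSETS_def' by auto

lemma coset_eq_iff: "\<lbrakk>x \<in> I; y \<in> I\<rbrakk> \<Longrightarrow> J +> x = J +> y \<longleftrightarrow> x \<ominus> y \<in> J"
  using quotient_eq_iff_same_a_r_cos[OF J] I.Icarr by blast

lemma submodule_coset_image:
  assumes K: "ideal K R" and KI: "K \<subseteq> I"
  shows "submodule (R Quot max_ideal R) {J +> x |x. x \<in> K} (residue_space R I J)"
proof -
  interpret K: ideal K R by (rule K)
  show ?thesis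
  proof (rule submodule.intro)
    show "module (R Quot max_ideal R) (residue_space R I J)" ..
    show "{J +> x |x. x \<in> K} \<subseteq> carrier (residue_space R I J)"
      using KI by (auto simp: carrier_residue_space)
    have "J = J +> \<zero>" using J.a_subset by simp
    then show "\<zero>\<^bsub>residue_space R I J\<^esub> \<in> {J +> x |x. x \<in> K}"
      unfolding zero_residue_space using K.zero_closed by blast
  next
    fix v w assume "v \<in> {J +> x |x. x \<in> K}" "w \<in> {J +> x |x. x \<in> K}"
    then obtain x y where "x \<in> K" "y \<in> K" "v = J +> x" "w = J +> y" by blast
    then show "v \<oplus>\<^bsub>residue_space R I J\<^esub> w \<in> {J +> x |x. x \<in> K}"
      using add_residue_space[of x y] KI K.a_closed by blast
  next
    fix c v assume "c \<in> carrier (R Quot max_ideal R)" "v \<in> {J +> x |x. x \<in> K}"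
    then obtain a x where "a \<in> carrier R" "x \<in> K" "c = max_ideal R +> a" "v = J +> x"
      unfolding carrier_residue_field by blast
    then show "c \<odot>\<^bsub>residue_space R I J\<^esub> v \<in> {J +> x |x. x \<in> K}"
      using smult_residue_space[of a x] KI K.I_l_closed by blast
  qed
qed

lemma ideal_coset_preimage:
  assumes U: "submodule (R Quot max_ideal R) U (residue_space R I J)"
  shows "ideal {x \<in> I. J +> x \<in> U} R" and "J \<subseteq> {x \<in> I. J +> x \<in> U}"
proof -
  interpret U: submodule "R Quot max_ideal R" U "residue_space R I J" by (rule U)
  have J0: "J +> x = \<zero>\<^bsub>residue_space R I J\<^esub>" if "x \<in> J" for x
    using a_rcos_zero[OF J that] by (simp add: zero_residue_space)
  show sub: "J \<subseteq> {x \<in> I. J +> x \<in> U}" using J0 JI U.zero_closed by auto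
  have mult: "a \<otimes> x \<in> {x \<in> I. J +> x \<in> U}" if "x \<in> {x \<in> I. J +> x \<in> U}" "a \<in> carrier R" for a x
    using that smult_residue_space[of a x] U.smult_closed[of "max_ideal R +> a" "J +> x"] I.I_l_closed
    by (auto simp: carrier_residue_field)
  show "ideal {x \<in> I. J +> x \<in> U} R"
  proof (rule idealI[OF ring_axioms])
    show "subgroup {x \<in> I. J +> x \<in> U} (add_monoid R)"
    proof (rule add.subgroupI)
      show "{x \<in> I. J +> x \<in> U} \<subseteq> carrier R" using I.Icarr by auto
      show "{x \<in> I. J +> x \<in> U} \<noteq> {}" using sub J.zero_closed by blast
      show "\<ominus> x \<in> {x \<in> I. J +> x \<in> U}" if "x \<in> {x \<in> I. J +> x \<in> U}" for x
        using mult[OF that, of "\<ominus> \<one>"] that I.Icarr by (auto simp: l_minus)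
      show "x \<oplus> y \<in> {x \<in> I. J +> x \<in> U}"
        if "x \<in> {x \<in> I. J +> x \<in> U}" "y \<in> {x \<in> I. J +> x \<in> U}" for x y
        using that add_residue_space[of x y] U.m_closed[of "J +> x" "J +> y"] I.a_closed by auto
    qed
    show "a \<otimes> x \<in> {x \<in> I. J +> x \<in> U}" if "x \<in> {x \<in> I. J +> x \<in> U}" "a \<in> carrier R" for a x
      by (rule mult[OF that])
    show "x \<otimes> a \<in> {x \<in> I. J +> x \<in> U}" if "x \<in> {x \<in> I. J +> x \<in> U}" "a \<in> carrier R" for a x
      using mult[OF that] m_comm[of a x] that I.Icarr by auto
  qed
qed

lemma residue_dim_le_card:
  assumes Z: "finite Z" "Z \<subseteq> I" and gen: "I \<subseteq> Idl (Z \<union> J)"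
  shows "residue_dim R I J \<le> card Z"
proof -
  let ?A = "(\<lambda>x. J +> x) ` Z"
  have Ac: "?A \<subseteq> carrier (residue_space R I J)" using Z by (auto simp: carrier_residue_space)
  note U = V.span_is_submodule[OF Ac]
  have "Z \<union> J \<subseteq> {x \<in> I. J +> x \<in> V.span ?A}"
    using ideal_coset_preimage(2)[OF U] Z V.in_own_span[OF Ac] by auto
  then have "I \<subseteq> {x \<in> I. J +> x \<in> V.span ?A}"
    using gen genideal_minimal[OF ideal_coset_preimage(1)[OF U]] by blast
  then have "V.gen_set ?A"
    using V.span_is_subset2[OF Ac] by (auto simp: carrier_residue_space)
  then have "V.dim \<le> card ?A" using Z Ac by (intro V.gen_ge_dim) auto
  also have "\<dots> \<le> card Z" using Z by (intro card_image_le)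
  finally show ?thesis by (simp add: residue_dim_def)
qed

text \<open>A class that is nonzero in \<open>I/J\<close> can replace a member of a basis, by Steinitz exchange; \<open>X\<close>
  consists of representatives of the members that remain.\<close>
lemma generating_set_containing:
  assumes fd: "V.fin_dim" and a: "a \<in> I" "a \<notin> J"
  obtains X where "finite X" "X \<subseteq> I" "card X < residue_dim R I J" "I \<subseteq> Idl (insert a X \<union> J)"
proof -
  obtain B where B: "finite B" "V.basis B" using V.finite_basis_exists[OF fd] by blast
  have dim: "residue_dim R I J = card B" using V.dim_basis[OF B] by (simp add: residue_dim_def)
  have Bc: "B \<subseteq> carrier (residue_space R I J)" and Bs: "V.span B = carrier (residue_space R I J)"
    using B unfolding V.basis_def by auto
  have ac: "J +> a \<in> carrier (residue_space R I J)" using a by (auto simp: carrier_residue_space)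
  have "J +> a \<noteq> \<zero>\<^bsub>residue_space R I J\<^esub>"
    using a J.a_rcos_self[of a] I.Icarr by (auto simp: zero_residue_space)
  then have li: "V.lin_indpt {J +> a}"
    using V.lin_dep_iff_in_span[of "{}" "J +> a"] ac by (auto simp: V.lin_dep_def V.span_empty)
  obtain C where C: "finite C" "C \<subseteq> carrier (residue_space R I J)"
    "int (card C) \<le> int (card B) - int (card {J +> a})" "V.span ({J +> a} \<union> C) = V.span B"
    using V.replacement[of "{J +> a}" B] B(1) Bc li ac Bs by auto
  obtain X where X: "finite X" "X \<subseteq> I" "C = (\<lambda>x. J +> x) ` X" "card X = card C"
  proof -
    have "C \<subseteq> (\<lambda>x. J +> x) ` I" using C(2) by (auto simp: carrier_residue_space)
    then obtain X where "X \<subseteq> I" "C = (\<lambda>x. J +> x) ` X" "inj_on (\<lambda>x. J +> x) X"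
      by (meson subset_image_inj)
    then show ?thesis using that C(1) card_image finite_image_iff by metis
  qed
  let ?K = "Idl (insert a X \<union> J)"
  have K: "ideal ?K R" using a X by (intro genideal_ideal) (auto simp: I.Icarr J.Icarr)
  interpret K: ideal ?K R by (rule K)
  have gK: "insert a X \<union> J \<subseteq> ?K" using a X by (intro genideal_self) (auto simp: I.Icarr J.Icarr)
  have KI: "?K \<subseteq> I" using genideal_minimal[OF I, of "insert a X \<union> J"] a X JI by blast
  have "V.span ({J +> a} \<union> C) \<subseteq> {J +> x |x. x \<in> ?K}"
    by (rule V.span_is_subset[OF _ submodule_coset_image[OF K KI]]) (use X gK in auto)
  then have sub: "{J +> x |x. x \<in> I} \<subseteq> {J +> x |x. x \<in> ?K}"
    using C(4) Bs by (simp add: carrier_residue_space)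
  have "I \<subseteq> ?K"
  proof
    fix x assume x: "x \<in> I"
    then obtain y where y: "y \<in> ?K" "J +> x = J +> y" using sub by blast
    then have "x \<ominus> y \<in> J" using coset_eq_iff[of x y] x KI by blast
    then have "x \<ominus> y \<oplus> y \<in> ?K" using gK y K.a_closed by blast
    moreover have "x \<ominus> y \<oplus> y = x" using x y I.Icarr K.Icarr by algebra
    ultimately show "x \<in> ?K" by simp
  qed
  moreover have "card X < residue_dim R I J" using C(3) X(4) dim by simp
  ultimately show ?thesis using that X by blast
qed

text \<open>A descending chain of subspaces of \<open>I/J\<close> is the image of the descending chain of its preimages,
  which are ideals.\<close>
lemma fin_dim_if_artinian:
  assumes "artin_local_ring R"
  shows "V.fin_dim"
proof (rule V.fin_dim_if_descending_chains)
  interpret artin_local_ring R by (rule assms)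
  fix W :: "nat \<Rightarrow> 'a set set"
  assume W: "\<And>n. submodule (R Quot max_ideal R) (W n) (residue_space R I J)" "\<And>n. W (Suc n) \<subseteq> W n"
  define K where "K n = {x \<in> I. J +> x \<in> W n}" for n
  have "\<exists>n. \<forall>m\<ge>n. K m = K n"
    by (rule descending_chains) (use ideal_coset_preimage(1)[OF W(1)] W(2) in \<open>auto simp: K_def\<close>)
  then obtain n where n: "K (Suc n) = K n" using le_SucI[OF order_refl] by blast
  have "W n = (\<lambda>x. J +> x) ` K n" for n
    using submodule.subset[OF W(1)[of n]] by (auto simp: K_def carrier_residue_space)
  then show "\<exists>n. W (Suc n) = W n" using n by metis
qed

end

section \<open>Compressed rings in degree two\<close>

lemma binomial_upper_mono:
  fixes m n k :: nat
  assumes "n \<le> m"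
  shows "n choose k \<le> m choose k"
proof (rule lift_Suc_mono_le[OF _ assms])
  show "n choose k \<le> Suc n choose k" for n by (cases k) auto
qed

text \<open>With \<open>d = e + 1\<close> variables there are \<open>(e + i) choose e\<close> monomials of degree \<open>i\<close>. This is increasing
  in \<open>i\<close>, and \<open>s - 2 \<ge> 2\<close>, so the minimum of the values for \<open>i = 2\<close> and \<open>i = s - 2\<close> is the former.\<close>
lemma compressed_hilbert_function_2:
  assumes "compressed Q" and s: "loewy_length Q \<ge> 4"
  shows "hilbert_function Q 2 \<ge> (hilbert_function Q 1 + 1) choose 2"
proof (cases "hilbert_function Q 1")
  case 0
  then show ?thesis by (simp add: numeral_2_eq_2)
next
  case (Suc e)
  let ?s = "loewy_length Q"
  have H2: "hilbert_function Q 2 = min ((Suc e + 2 - 1) choose 2) ((Suc e + ?s - 2 - 1) choose (?s - 2))"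
  proof -
    have "2 \<le> ?s" using s by simp
    then show ?thesis
      using \<open>compressed Q\<close> unfolding compressed_def embedding_dim_def Let_def Suc by blast
  qed
  have "(e + 2) choose 2 = (e + 2) choose e" using binomial_symmetric[of 2 "e + 2"] by simp
  also have "\<dots> \<le> (e + (?s - 2)) choose e" using s by (intro binomial_upper_mono) auto
  also have "\<dots> = (e + (?s - 2)) choose (?s - 2)"
    using binomial_symmetric[of e "e + (?s - 2)"] by simp
  also have "e + (?s - 2) = Suc e + ?s - 2 - 1" using s by simp
  finally have "(e + 2) choose 2 \<le> (Suc e + ?s - 2 - 1) choose (?s - 2)" .
  moreover have "Suc e + 2 - 1 = e + 2" "hilbert_function Q 1 + 1 = e + 2" using Suc by simp_all
  ultimately show ?thesis unfolding H2 by (metis min.boundedI order_refl)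
qed

section \<open>Artinian local rings\<close>

lemma (in local_ring) max_ideal_if_nonunit:
  assumes x: "x \<in> carrier R" "x \<notin> Units R"
  shows "x \<in> max_ideal R"
proof -
  let ?S = "{I. ideal I R \<and> x \<in> I \<and> \<one> \<notin> I}"
  have "\<exists>M\<in>?S. \<forall>I\<in>?S. M \<subseteq> I \<longrightarrow> I = M"
  proof (rule subset_Zorn_nonempty)
    have "\<one> \<notin> PIdl x"
    proof
      assume "\<one> \<in> PIdl x"
      then obtain y where "y \<in> carrier R" "\<one> = y \<otimes> x" by (auto simp: cgenideal_def)
      then show False using x m_comm[of x y] unfolding Units_def by auto
    qed
    then have "PIdl x \<in> ?S" using cgenideal_ideal cgenideal_self x by simp
    then show "?S \<noteq> {}" by blast
  next
    fix C assume C: "C \<noteq> {}" "subset.chain ?S C"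
    then have "subset.chain {I. ideal I R} C" by (auto simp: subset_chain_def)
    then have "ideal (\<Union>C) R" using chain_Union_is_ideal[of C] C(1) by simp
    then show "\<Union>C \<in> ?S" using C by (auto simp: subset_chain_def)
  qed
  then obtain M where M: "ideal M R" "x \<in> M" "\<one> \<notin> M"
    and max: "\<And>I. \<lbrakk>ideal I R; x \<in> I; \<one> \<notin> I; M \<subseteq> I\<rbrakk> \<Longrightarrow> I = M" by blast
  have "maximalideal M R"
  proof (rule maximalidealI[OF M(1)])
    show "carrier R \<noteq> M" using M(3) one_closed by blast
    show "K = M \<or> K = carrier R" if K: "ideal K R" "M \<subseteq> K" "K \<subseteq> carrier R" for K
      using max[OF K(1) _ _ K(2)] M(2) K ideal.one_imp_carrier[OF K(1)] by blast
  qed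
  then have "M = max_ideal R" using unique_maximal maximalideal_max_ideal by blast
  then show ?thesis using M by simp
qed

lemma (in local_ring) one_notin_max_ideal: "\<one> \<notin> max_ideal R"
  using maximalideal_max_ideal ideal.one_imp_carrier[OF ideal_max_ideal] maximalideal.I_notcarr
  by metis

text \<open>This is the cyclic case of Nakayama's lemma: \<open>(1 - h) x = 0\<close>, and \<open>1 - h\<close> is a unit.\<close>
lemma (in local_ring) zero_if_absorbed:
  assumes h: "h \<in> max_ideal R" and x: "x \<in> carrier R" and eq: "x = h \<otimes> x"
  shows "x = \<zero>"
proof -
  interpret M: ideal "max_ideal R" R by (rule ideal_max_ideal)
  have hc: "h \<in> carrier R" using h by (rule M.Icarr)
  have "\<one> \<ominus> h \<notin> max_ideal R"
  proof
    assume "\<one> \<ominus> h \<in> max_ideal R"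
    then have "\<one> \<ominus> h \<oplus> h \<in> max_ideal R" using h by (rule M.a_closed)
    moreover have "\<one> \<ominus> h \<oplus> h = \<one>" using hc by algebra
    ultimately show False using one_notin_max_ideal by simp
  qed
  then have u: "\<one> \<ominus> h \<in> Units R" using max_ideal_if_nonunit hc by blast
  have "(\<one> \<ominus> h) \<otimes> x = x \<ominus> h \<otimes> x" using hc x by algebra
  also have "\<dots> = \<zero>" using eq x by (metis r_right_minus_eq)
  finally have "inv (\<one> \<ominus> h) \<otimes> ((\<one> \<ominus> h) \<otimes> x) = \<zero>" using u by simp
  then show ?thesis using u x hc by (simp flip: m_assoc)
qed

lemma (in artin_local_ring) minimal_ideal_exists:
  assumes I0: "I0 \<in> S" and S: "\<And>I. I \<in> S \<Longrightarrow> ideal I R"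
  obtains I where "I \<in> S" "\<And>K. \<lbrakk>K \<in> S; K \<subseteq> I\<rbrakk> \<Longrightarrow> K = I"
proof (rule ccontr)
  assume "\<not> thesis"
  then have "\<forall>I\<in>S. \<exists>K. K \<in> S \<and> K \<subset> I" using that by blast
  then obtain g where g: "\<And>I. I \<in> S \<Longrightarrow> g I \<in> S \<and> g I \<subset> I" by metis
  define K where "K n = (g ^^ n) I0" for n
  have K: "K n \<in> S" for n by (induction n) (auto simp: K_def I0 g)
  have lt: "K (Suc n) \<subset> K n" for n using g[OF K[of n]] by (simp add: K_def)
  have "\<exists>n. \<forall>m\<ge>n. K m = K n"
    by (rule descending_chains) (use S K lt in blast)+
  then show False using lt by (metis le_SucI order_refl psubset_eq)
qed

lemma (in cring) annihilates_ideal_prod: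
  assumes x: "x \<in> carrier R" and I: "ideal I R" and J: "ideal J R"
    and zero: "\<And>a b. \<lbrakk>a \<in> I; b \<in> J\<rbrakk> \<Longrightarrow> x \<otimes> (a \<otimes> b) = \<zero>"
    and y: "y \<in> ideal_prod R I J"
  shows "x \<otimes> y = \<zero>"
  using y
proof (induction y rule: ideal_prod.induct)
  case (sum a b)
  then have "a \<in> carrier R" "b \<in> carrier R" using ideal_prod_in_carrier[OF I J] by auto
  then show ?case using sum x by (simp add: r_distr)
qed (rule zero)

lemma (in cring) ideal_power_Suc_subset:
  "ideal I R \<Longrightarrow> ideal_power R I (Suc n) \<subseteq> ideal_power R I n"
  using ideal_prod_inter[of I "ideal_power R I n"] ideal_ideal_power[of I n] by auto

text \<open>The powers of \<open>\<mm>\<close> become stationary at an ideal \<open>I = \<mm> I\<close>. If \<open>I \<noteq> 0\<close>, take a minimal ideal \<open>J\<close> with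
  \<open>J I \<noteq> 0\<close> and \<open>x \<in> J\<close> with \<open>x I \<noteq> 0\<close>. Since \<open>x I = x \<mm> I\<close>, already some multiple \<open>x a\<close> with
  \<open>a \<in> \<mm>\<close> satisfies \<open>x a I \<noteq> 0\<close>. By minimality \<open>x a\<close> generates \<open>J\<close>, so \<open>x\<close> is a multiple of \<open>x a\<close>
  and therefore zero.\<close>
lemma (in artin_local_ring) max_ideal_nilpotent:
  obtains n where "ideal_power R (max_ideal R) n = {\<zero>}"
proof -
  let ?m = "max_ideal R"
  note m = ideal_max_ideal
  interpret M: ideal ?m R by (rule m)
  have "\<exists>n. \<forall>k\<ge>n. ideal_power R ?m k = ideal_power R ?m n"
    by (rule descending_chains) (use ideal_ideal_power[OF m] ideal_power_Suc_subset[OF m] in blast)+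
  then obtain n where "ideal_power R ?m (Suc n) = ideal_power R ?m n"
    using le_SucI[OF order_refl] by blast
  define I where "I = ideal_power R ?m n"
  have mI: "ideal_prod R ?m I = I" using \<open>ideal_power R ?m (Suc n) = _\<close> by (simp add: I_def)
  have I: "ideal I R" using ideal_ideal_power[OF m] by (simp add: I_def)
  interpret I: ideal I R by (rule I)
  have "I = {\<zero>}"
  proof (rule ccontr)
    assume "I \<noteq> {\<zero>}"
    then obtain y0 where y0: "y0 \<in> I" "y0 \<noteq> \<zero>" using I.zero_closed by blast
    let ?S = "{J. ideal J R \<and> (\<exists>x\<in>J. \<exists>y\<in>I. x \<otimes> y \<noteq> \<zero>)}"
    have "\<one> \<otimes> y0 \<noteq> \<zero>" using y0 I.Icarr by simp
    then have "carrier R \<in> ?S" using oneideal y0 one_closed by blast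
    then obtain J where J: "J \<in> ?S" and min: "\<And>K. \<lbrakk>K \<in> ?S; K \<subseteq> J\<rbrakk> \<Longrightarrow> K = J"
      by (rule minimal_ideal_exists) auto
    then obtain x y where xy: "x \<in> J" "y \<in> I" "x \<otimes> y \<noteq> \<zero>" by blast
    interpret J: ideal J R using J by simp
    have x: "x \<in> carrier R" using xy by (simp add: J.Icarr)
    have "\<not> (\<forall>a\<in>?m. \<forall>b\<in>I. x \<otimes> (a \<otimes> b) = \<zero>)"
      using annihilates_ideal_prod[OF x m I, of y] xy mI by blast
    then obtain a b where ab: "a \<in> ?m" "b \<in> I" "x \<otimes> (a \<otimes> b) \<noteq> \<zero>" by blast
    have ac: "a \<in> carrier R" "b \<in> carrier R" using ab by (auto simp: M.Icarr I.Icarr)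
    have xa: "x \<otimes> a \<in> carrier R" using x ac by simp
    have "(x \<otimes> a) \<otimes> b \<noteq> \<zero>" using ab ac x by (simp add: m_assoc)
    then have "PIdl (x \<otimes> a) \<in> ?S" using cgenideal_ideal[OF xa] cgenideal_self[OF xa] ab by blast
    moreover have "PIdl (x \<otimes> a) \<subseteq> J"
      using cgenideal_minimal[OF J.ideal_axioms J.I_r_closed] xy ac by blast
    ultimately have "x \<in> PIdl (x \<otimes> a)" using min xy by blast
    then obtain r where r: "r \<in> carrier R" "x = r \<otimes> (x \<otimes> a)" by (auto simp: cgenideal_def)
    have "r \<otimes> (x \<otimes> a) = (r \<otimes> a) \<otimes> x" using r(1) x ac by algebra
    then have "x = \<zero>" using zero_if_absorbed[of "r \<otimes> a" x] r M.I_l_closed[OF ab(1) r(1)] x by simp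
    then show False using xy I.Icarr by simp
  qed
  then show ?thesis using that unfolding I_def by blast
qed

text \<open>The hypothesis says \<open>a \<mm> \<subseteq> a \<mm>\<^sup>2\<close>. Multiplying by powers of \<open>\<mm>\<close> gives \<open>a \<mm> \<subseteq> a \<mm>\<^sup>n\<close> for all \<open>n\<close>,
  and \<open>\<mm>\<close> is nilpotent. This is Nakayama's lemma for the module \<open>a \<mm>\<close>, with nilpotency of \<open>\<mm>\<close> in
  the place of finite generation.\<close>
lemma (in artin_local_ring) annihilates_max_ideal:
  defines "m \<equiv> max_ideal R"
  assumes a: "a \<in> carrier R"
    and step: "\<And>x. x \<in> m \<Longrightarrow> \<exists>x' \<in> ideal_power R m 2. a \<otimes> x = a \<otimes> x'"
    and x: "x \<in> m"
  shows "a \<otimes> x = \<zero>"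
proof -
  have m: "ideal m R" unfolding m_def by (rule ideal_max_ideal)
  interpret M: ideal m R by (rule m)
  note pow = ideal_ideal_power[OF m]
  have push: "\<exists>x' \<in> ideal_power R m (Suc (Suc n)). a \<otimes> x = a \<otimes> x'"
    if "x \<in> ideal_power R m (Suc n)" for x n
    using that
  proof (induction n arbitrary: x)
    case 0
    then show ?case using step[of x] ideal_prod_one[OF m] by (simp add: numeral_2_eq_2)
  next
    case (Suc n)
    let ?I = "ideal_power R m (Suc n)" and ?J = "ideal_power R m (Suc (Suc n))"
    interpret I: ideal ?I R by (rule pow)
    interpret J: ideal ?J R by (rule pow)
    interpret J': ideal "ideal_power R m (Suc (Suc (Suc n)))" R by (rule pow)
    have "x \<in> ideal_prod R m ?I" using Suc.prems by simp
    then show ?case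
    proof (induction x rule: ideal_prod.induct)
      case (prod y z)
      obtain z' where z': "z' \<in> ?J" "a \<otimes> z = a \<otimes> z'" using Suc.IH[OF prod(2)] by blast
      have c: "y \<in> carrier R" "z \<in> carrier R" "z' \<in> carrier R"
        using prod z'(1) M.Icarr I.Icarr J.Icarr by auto
      have "a \<otimes> (y \<otimes> z) = y \<otimes> (a \<otimes> z)" using a c(1,2) by algebra
      also have "\<dots> = a \<otimes> (y \<otimes> z')" unfolding z'(2) using a c(1,3) by algebra
      finally have "a \<otimes> (y \<otimes> z) = a \<otimes> (y \<otimes> z')" .
      moreover have "y \<otimes> z' \<in> ideal_power R m (Suc (Suc (Suc n)))"
        unfolding ideal_power.simps(2)[of R m "Suc (Suc n)"]
        using prod(1) z'(1) by (rule ideal_prod.prod)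
      ultimately show ?case by blast
    next
      case (sum y z)
      obtain y' z' where yz: "y' \<in> ideal_power R m (Suc (Suc (Suc n)))" "a \<otimes> y = a \<otimes> y'"
        "z' \<in> ideal_power R m (Suc (Suc (Suc n)))" "a \<otimes> z = a \<otimes> z'"
        using sum.IH by blast
      have c: "y \<in> carrier R" "z \<in> carrier R" "y' \<in> carrier R" "z' \<in> carrier R"
        using sum.hyps ideal_prod_in_carrier[OF m pow[of "Suc n"]] J'.Icarr[OF yz(1)] J'.Icarr[OF yz(3)]
        by blast+
      have "a \<otimes> (y \<oplus> z) = a \<otimes> (y' \<oplus> z')"
        unfolding r_distr[OF c(1,2) a] r_distr[OF c(3,4) a] yz(2,4) ..
      then show ?case using J'.a_closed[OF yz(1,3)] by blast
    qed
  qed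
  have "\<exists>x' \<in> ideal_power R m (Suc n). a \<otimes> x = a \<otimes> x'" for n
  proof (induction n)
    case 0
    then show ?case using x ideal_prod_one[OF m] by auto
  next
    case (Suc n)
    then obtain x' where "x' \<in> ideal_power R m (Suc n)" "a \<otimes> x = a \<otimes> x'" by blast
    then show ?case using push[of x' n] by auto
  qed
  moreover obtain n where "ideal_power R m n = {\<zero>}"
    using max_ideal_nilpotent unfolding m_def .
  ultimately obtain x' where "x' \<in> {\<zero>}" "a \<otimes> x = a \<otimes> x'"
    using ideal_power_Suc_subset[OF m, of n] by blast
  then show ?thesis using a by simp
qed

section \<open>Products of two elements of the maximal ideal\<close>

lemma (in cring) card_products_le:
  assumes "finite X" "X \<subseteq> carrier R"
  shows "finite {x \<otimes> y |x y. x \<in> X \<and> y \<in> X}" (is ?fin)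
    and "card {x \<otimes> y |x y. x \<in> X \<and> y \<in> X} \<le> (card X + 1) choose 2" (is ?card)
proof -
  have "?fin \<and> ?card" using assms
  proof (induction X)
    case (insert z X)
    let ?P = "\<lambda>X. {x \<otimes> y |x y. x \<in> X \<and> y \<in> X}"
    let ?Q = "(\<lambda>y. z \<otimes> y) ` insert z X"
    have IH: "finite (?P X)" "card (?P X) \<le> (card X + 1) choose 2" using insert by auto
    have "?P (insert z X) \<subseteq> ?P X \<union> ?Q"
    proof
      fix w assume "w \<in> ?P (insert z X)"
      then obtain x y where "x \<in> insert z X" "y \<in> insert z X" "w = x \<otimes> y" by blast
      then show "w \<in> ?P X \<union> ?Q" using insert.prems m_comm[of x z] by blast
    qed
    then have sub: "finite (?P (insert z X))" "card (?P (insert z X)) \<le> card (?P X \<union> ?Q)"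
      using IH insert.hyps by (auto intro: finite_subset card_mono)
    note sub(2)
    also have "card (?P X \<union> ?Q) \<le> card (?P X) + card ?Q" by (rule card_Un_le)
    also have "card ?Q \<le> card X + 1"
      using card_image_le[of "insert z X" "\<lambda>y. z \<otimes> y"] insert.hyps by simp
    finally have "card (?P (insert z X)) \<le> ((card X + 1) choose 2) + (card X + 1)" using IH by simp
    also have "\<dots> = (card (insert z X) + 1) choose 2"
      using insert.hyps by (simp add: numeral_2_eq_2)
    finally show ?case using sub by simp
  qed (simp_all add: numeral_2_eq_2)
  then show ?fin ?card by auto
qed

lemma (in cring) mult_in_ideal_if_on_generators:
  assumes a: "a \<in> carrier R" and K: "ideal K R" and S: "S \<subseteq> carrier R"
    and gen: "\<And>s. s \<in> S \<Longrightarrow> a \<otimes> s \<in> K" and y: "y \<in> Idl S"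
  shows "a \<otimes> y \<in> K"
  using genideal_minimal[OF ideal.helper_max_prime[OF K is_cring a], of S] S gen y by blast

text \<open>Complete \<open>a\<close> and \<open>b\<close> to generators \<open>{a} \<union> X\<close> and \<open>{b} \<union> Y\<close> of \<open>\<mm>\<close> modulo \<open>\<mm>\<^sup>2\<close>. Modulo \<open>\<mm>\<^sup>3\<close>, the
  ideal \<open>a \<mm>\<close> is generated by the \<open>a y\<close> with \<open>y \<in> Y\<close>, because \<open>a b\<close> contributes nothing, and the rest
  of \<open>\<mm>\<^sup>2\<close> by the products \<open>x x'\<close> with \<open>x, x' \<in> X\<close>. With \<open>d\<close> the dimension of \<open>\<mm>/\<mm>\<^sup>2\<close> these are at
  most \<open>(d - 1) + (d choose 2)\<close> elements, one fewer than \<open>(d + 1) choose 2\<close>. Completing \<open>a\<close> and \<open>b\<close>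
  separately treats linearly dependent and independent classes modulo \<open>\<mm>\<^sup>2\<close> at once.\<close>
lemma (in artin_local_ring) hilbert_function_2_less:
  defines "m \<equiv> max_ideal R"
  assumes a: "a \<in> m" "a \<notin> ideal_power R m 2" and b: "b \<in> m" "b \<notin> ideal_power R m 2"
    and ab: "a \<otimes> b \<in> ideal_power R m 3"
  shows "hilbert_function R 2 < (hilbert_function R 1 + 1) choose 2"
proof -
  let ?d = "hilbert_function R 1"
  have m: "ideal m R" unfolding m_def by (rule ideal_max_ideal)
  interpret M: ideal m R by (rule m)
  note pow = ideal_ideal_power[OF m] and dec = ideal_power_Suc_subset[OF m]
  have m1: "ideal_power R m 1 = m" using ideal_prod_one[OF m] by simp
  have m2: "ideal_power R m 2 = ideal_prod R m m" using m1 by (simp add: numeral_2_eq_2)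
  have m3: "ideal_power R m 3 = ideal_prod R m (ideal_power R m 2)"
    by (simp add: numeral_3_eq_3 numeral_2_eq_2)
  have rq: "residue_quotient R (ideal_power R m n) (ideal_power R m (Suc n))" for n
    by (intro residue_quotient.intro residue_quotient_axioms.intro pow dec local_ring_axioms)
      (simp add: m_def)
  interpret M2: ideal "ideal_power R m 2" R by (rule pow)
  interpret M3: ideal "ideal_power R m 3" R by (rule pow)
  interpret D1: residue_quotient R m "ideal_power R m 2"
    using rq[of 1] m1 by (simp add: numeral_2_eq_2)
  interpret D2: residue_quotient R "ideal_power R m 2" "ideal_power R m 3"
    using rq[of 2] by (simp add: numeral_3_eq_3 numeral_2_eq_2)
  have dim1: "residue_dim R m (ideal_power R m 2) = ?d"
    using m1 unfolding hilbert_function_def m_def by (simp add: numeral_2_eq_2)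
  have dim2: "residue_dim R (ideal_power R m 2) (ideal_power R m 3) = hilbert_function R 2"
    unfolding hilbert_function_def m_def by (simp add: numeral_2_eq_2 numeral_3_eq_3)
  note fd = D1.fin_dim_if_artinian[OF artin_local_ring_axioms]
  obtain X where X: "finite X" "X \<subseteq> m" "card X < ?d" "m \<subseteq> Idl (insert a X \<union> ideal_power R m 2)"
    using D1.generating_set_containing[OF fd a] dim1 by metis
  obtain Y where Y: "finite Y" "Y \<subseteq> m" "card Y < ?d" "m \<subseteq> Idl (insert b Y \<union> ideal_power R m 2)"
    using D1.generating_set_containing[OF fd b] dim1 by metis
  let ?P = "{x \<otimes> y |x y. x \<in> X \<and> y \<in> X}"
  define Z where "Z = (\<lambda>y. a \<otimes> y) ` Y \<union> ?P"
  have Xc: "X \<subseteq> carrier R" using X(2) M.Icarr by blast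
  have Z2: "Z \<subseteq> ideal_power R m 2"
    unfolding Z_def m2 using a(1) X(2) Y(2) by (auto intro: ideal_prod.prod)
  have Zfin: "finite Z" unfolding Z_def using Y(1) card_products_le(1)[OF X(1) Xc] by simp
  define K where "K = Idl (Z \<union> ideal_power R m 3)"
  have Zc: "Z \<union> ideal_power R m 3 \<subseteq> carrier R" using Z2 M2.Icarr M3.Icarr by blast
  have K: "ideal K R" unfolding K_def by (rule genideal_ideal[OF Zc])
  have ZK: "Z \<subseteq> K" and m3K: "ideal_power R m 3 \<subseteq> K"
    using genideal_self[OF Zc] unfolding K_def by auto
  have cube: "x \<otimes> y \<in> K" if "x \<in> m" "y \<in> ideal_power R m 2" for x y
    using that m3K unfolding m3 by (blast intro: ideal_prod.prod)
  have gens_carrier: "insert x X' \<union> ideal_power R m 2 \<subseteq> carrier R" if "x \<in> m" "X' \<subseteq> m" for x X'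
    using that M.Icarr M2.Icarr by blast
  \<comment> \<open>For fixed \<open>x\<close> the \<open>y\<close> with \<open>x y \<in> K\<close> form an ideal, so it suffices to test generators: first for
    \<open>x = a\<close>, then for \<open>x \<in> X\<close>, where the generator \<open>a\<close> is covered by the first step, and finally for
    all of \<open>\<mm>\<close>.\<close>
  have aK: "a \<otimes> y \<in> K" if "y \<in> m" for y
  proof (rule mult_in_ideal_if_on_generators[OF M.Icarr[OF a(1)] K gens_carrier[OF b(1) Y(2)]])
    show "y \<in> Idl (insert b Y \<union> ideal_power R m 2)" using that Y by blast
    show "a \<otimes> s \<in> K" if "s \<in> insert b Y \<union> ideal_power R m 2" for s
      using that ab m3K ZK cube a(1) unfolding Z_def by blast
  qed
  have XK: "x \<otimes> y \<in> K" if "x \<in> X" "y \<in> m" for x y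
  proof (rule mult_in_ideal_if_on_generators[OF _ K gens_carrier[OF a(1) X(2)]])
    show xc: "x \<in> carrier R" using that Xc by blast
    show "y \<in> Idl (insert a X \<union> ideal_power R m 2)" using that X by blast
    have "x \<otimes> a \<in> K" using aK[of x] that X(2) m_comm[of x a] xc M.Icarr[OF a(1)] by auto
    then show "x \<otimes> s \<in> K" if "s \<in> insert a X \<union> ideal_power R m 2" for s
      using that \<open>x \<in> X\<close> X(2) ZK cube unfolding Z_def by blast
  qed
  have mK: "x \<otimes> y \<in> K" if xy: "x \<in> m" "y \<in> m" for x y
  proof -
    have "y \<otimes> x \<in> K"
    proof (rule mult_in_ideal_if_on_generators[OF M.Icarr[OF xy(2)] K gens_carrier[OF a(1) X(2)]])
      show "x \<in> Idl (insert a X \<union> ideal_power R m 2)" using xy X by blast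
      show "y \<otimes> s \<in> K" if s: "s \<in> insert a X \<union> ideal_power R m 2" for s
      proof (cases "s \<in> ideal_power R m 2")
        case False
        then have "s \<otimes> y \<in> K" using s aK XK xy by blast
        moreover have "s \<in> carrier R" using s gens_carrier[OF a(1) X(2)] by blast
        ultimately show ?thesis using m_comm[of s y] M.Icarr[OF xy(2)] by simp
      qed (use cube xy in blast)
    qed
    then show ?thesis using m_comm[of x y] M.Icarr xy by simp
  qed
  interpret K: ideal K R by (rule K)
  have "ideal_power R m 2 \<subseteq> K"
  proof
    fix z assume "z \<in> ideal_power R m 2"
    then have "z \<in> ideal_prod R m m" using m2 by simp
    then show "z \<in> K" by induction (use mK K.a_closed in auto)
  qed
  then have "hilbert_function R 2 \<le> card Z"
    using D2.residue_dim_le_card[OF Zfin Z2] dim2 unfolding K_def by simp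
  also have "card Z \<le> card ((\<lambda>y. a \<otimes> y) ` Y) + card ?P" unfolding Z_def by (rule card_Un_le)
  also have "\<dots> \<le> card Y + ((card X + 1) choose 2)"
    using card_image_le[OF Y(1)] card_products_le(2)[OF X(1) Xc] by (intro add_mono)
  also have "\<dots> < ?d + (?d choose 2)"
    using X(3) Y(3) by (intro add_less_le_mono binomial_upper_mono) auto
  also have "\<dots> = (?d + 1) choose 2" by (simp add: numeral_2_eq_2)
  finally show ?thesis .
qed

text \<open>Elements \<open>a \<in> A\<close> and \<open>b \<in> B\<close> cannot both lie outside \<open>\<mm>\<^sup>2\<close>, as \<open>a b = 0\<close> would be a quadratic
  relation. So one part \<open>C\<close> is contained in \<open>\<mm>\<^sup>2\<close>. For \<open>c \<in> C\<close> only the summand from \<open>C\<close> matters in a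
  product with \<open>c\<close>, so \<open>c \<mm> \<subseteq> c C \<subseteq> c \<mm>\<^sup>2\<close> and thus \<open>c \<mm> = 0\<close>.\<close>
lemma (in artin_local_ring) orthogonal_splitting_trivial:
  defines "m \<equiv> max_ideal R"
  assumes A: "A \<subseteq> m" and B: "B \<subseteq> m"
    and sum: "\<And>x. x \<in> m \<Longrightarrow> \<exists>a\<in>A. \<exists>b\<in>B. x = a \<oplus> b"
    and orth: "\<And>a b. \<lbrakk>a \<in> A; b \<in> B\<rbrakk> \<Longrightarrow> a \<otimes> b = \<zero>"
    and H2: "hilbert_function R 2 \<ge> (hilbert_function R 1 + 1) choose 2"
  shows "(\<forall>a\<in>A. \<forall>a'\<in>A. a \<otimes> a' = \<zero>) \<or> (\<forall>b\<in>B. \<forall>b'\<in>B. b \<otimes> b' = \<zero>)"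
proof -
  have m: "ideal m R" unfolding m_def by (rule ideal_max_ideal)
  interpret M: ideal m R by (rule m)
  interpret M3: ideal "ideal_power R m 3" R by (rule ideal_ideal_power[OF m])
  \<comment> \<open>Stated for a splitting \<open>\<mm> = C + D\<close> so that it applies to \<open>A\<close> and \<open>B\<close> in either order.\<close>
  have trivial: "\<forall>c\<in>C. \<forall>c'\<in>C. c \<otimes> c' = \<zero>"
    if C: "C \<subseteq> ideal_power R m 2" "C \<subseteq> m" and D: "D \<subseteq> m"
      and sum: "\<And>x. x \<in> m \<Longrightarrow> \<exists>c\<in>C. \<exists>d\<in>D. x = c \<oplus> d"
      and orth: "\<And>c d. \<lbrakk>c \<in> C; d \<in> D\<rbrakk> \<Longrightarrow> c \<otimes> d = \<zero>" for C D
  proof (intro ballI)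
    fix c c' assume c: "c \<in> C" "c' \<in> C"
    have cc: "c \<in> carrier R" using c C M.Icarr by blast
    have "\<exists>x' \<in> ideal_power R m 2. c \<otimes> x = c \<otimes> x'" if x: "x \<in> m" for x
    proof -
      obtain e d where ed: "e \<in> C" "d \<in> D" "x = e \<oplus> d" using sum[OF x] by blast
      then have "e \<in> carrier R" "d \<in> carrier R" using C D M.Icarr by blast+
      then have "c \<otimes> x = c \<otimes> e" using ed cc orth[OF c(1) ed(2)] by (simp add: r_distr)
      then show ?thesis using ed C by blast
    qed
    then show "c \<otimes> c' = \<zero>"
      using annihilates_max_ideal[OF cc, folded m_def] c C by blast
  qed
  have "A \<subseteq> ideal_power R m 2 \<or> B \<subseteq> ideal_power R m 2"
  proof (rule ccontr)
    assume "\<not> ?thesis"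
    then obtain a b where "a \<in> A" "a \<notin> ideal_power R m 2" "b \<in> B" "b \<notin> ideal_power R m 2" by blast
    then have "hilbert_function R 2 < (hilbert_function R 1 + 1) choose 2"
      using hilbert_function_2_less[folded m_def, of a b] A B orth[of a b] M3.zero_closed by auto
    then show False using H2 by simp
  qed
  then show ?thesis
  proof
    assume "A \<subseteq> ideal_power R m 2"
    then show ?thesis using trivial[OF _ A B sum orth] by blast
  next
    assume B2: "B \<subseteq> ideal_power R m 2"
    have "\<exists>b\<in>B. \<exists>a\<in>A. x = b \<oplus> a" if "x \<in> m" for x
      using sum[OF that] A B M.Icarr a_comm by (metis subsetD)
    moreover have "b \<otimes> a = \<zero>" if "b \<in> B" "a \<in> A" for a b
      using orth[OF that(2,1)] that A B M.Icarr m_comm by (metis subsetD)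
    ultimately show ?thesis using trivial[OF B2 B A] by blast
  qed
qed

section \<open>Loewy length and socle\<close>

text \<open>If \<open>\<mm>\<^sup>2 = 0\<close>, the exponents of the nonvanishing powers of \<open>\<mm>\<close> are among \<open>0\<close> and \<open>1\<close>.\<close>
lemma (in local_ring) max_ideal_product_nonzero:
  assumes l: "loewy_length R \<ge> 2"
  obtains x y where "x \<in> max_ideal R" "y \<in> max_ideal R" "x \<otimes> y \<noteq> \<zero>"
proof (rule ccontr)
  let ?m = "max_ideal R"
  let ?N = "{n. ideal_power R ?m n \<noteq> {\<zero>}}"
  note m = ideal_max_ideal
  assume "\<not> thesis"
  then have zero: "\<forall>x\<in>?m. \<forall>y\<in>?m. x \<otimes> y = \<zero>" using that by blast
  have "ideal_power R ?m 2 = ideal_prod R ?m ?m"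
    using ideal_prod_one[OF m] by (simp add: numeral_2_eq_2)
  moreover have "z = \<zero>" if "z \<in> ideal_prod R ?m ?m" for z
    using that by (induction rule: ideal_prod.induct) (use zero in simp_all)
  ultimately have two: "ideal_power R ?m 2 \<subseteq> {\<zero>}" by blast
  have "ideal_power R ?m n = {\<zero>}" if "n \<ge> 2" for n
  proof -
    have "ideal_power R ?m n \<subseteq> ideal_power R ?m 2"
      by (rule lift_Suc_antimono_le[where f = "ideal_power R ?m", OF ideal_power_Suc_subset[OF m] that])
    moreover have "\<zero> \<in> ideal_power R ?m n"
      using additive_subgroup.zero_closed[OF ideal.axioms(1)[OF ideal_ideal_power[OF m]]] .
    ultimately show ?thesis using two by blast
  qed
  then have N: "n < 2" if "n \<in> ?N" for n
    using that linorder_not_le by blast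
  have "\<one> \<noteq> \<zero>" using one_notin_max_ideal
      additive_subgroup.zero_closed[OF ideal.axioms(1)[OF m]] by metis
  then have "0 \<in> ?N" using one_closed by auto
  moreover have "finite ?N" by (rule finite_subset[of _ "{..<2}"]) (use N in blast)+
  ultimately have "Max ?N \<in> ?N" by (intro Max_in) blast+
  then have "loewy_length R < 2" unfolding loewy_length_def by (rule N)
  then show False using l by simp
qed

text \<open>Dimension one excludes the zero socle, since the zero space is spanned by the empty set.\<close>
lemma (in gorenstein_artin_local_ring) socle_nonzero: "socle R \<noteq> {\<zero>}"
proof
  assume "socle R = {\<zero>}"
  then have one: "residue_dim R {\<zero>} {\<zero>} = 1" using type_one by simp
  interpret residue_quotient R "{\<zero>}" "{\<zero>}"
    by unfold_locales (auto simp: zeroideal ideal_prod_zero[OF ideal_max_ideal])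
  have "{\<zero>} \<subseteq> Idl ({} \<union> {\<zero>})" using genideal_self[of "{\<zero>}"] by simp
  then have "residue_dim R {\<zero>} {\<zero>} \<le> card ({} :: 'a set)" by (intro residue_dim_le_card) auto
  then show False using one by simp
qed

lemma (in gorenstein_artin_local_ring) socle_generator_annihilator:
  assumes d: "d \<in> carrier R" "socle R = PIdl d" and r: "r \<in> carrier R"
  shows "r \<otimes> d = \<zero> \<longleftrightarrow> r \<in> max_ideal R"
proof
  have "d \<in> socle R" using d cgenideal_self by simp
  then show "r \<otimes> d = \<zero>" if "r \<in> max_ideal R" using that by (simp add: socle_def)
  assume rd: "r \<otimes> d = \<zero>"
  show "r \<in> max_ideal R"
  proof (rule ccontr)
    assume "r \<notin> max_ideal R"
    then have u: "r \<in> Units R" using max_ideal_if_nonunit r by blast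
    then have "d = inv r \<otimes> (r \<otimes> d)" using d(1) r by (simp flip: m_assoc)
    then have "d = \<zero>" using rd u by simp
    then have "socle R = {\<zero>}" using d cgenideal_eq_genideal[of \<zero>] genideal_zero by simp
    then show False using socle_nonzero by simp
  qed
qed

text \<open>A unit in the socle would annihilate \<open>\<mm>\<close>, which is possible only if \<open>\<mm> = 0\<close>.\<close>
lemma (in local_ring) socle_subset_max_ideal:
  assumes "x \<in> max_ideal R" "x \<noteq> \<zero>"
  shows "socle R \<subseteq> max_ideal R"
proof
  fix z assume z: "z \<in> socle R"
  show "z \<in> max_ideal R"
  proof (rule ccontr)
    assume "z \<notin> max_ideal R"
    moreover have zc: "z \<in> carrier R" using z by (simp add: socle_def)
    ultimately have u: "z \<in> Units R" using max_ideal_if_nonunit by blast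
    have xc: "x \<in> carrier R" using assms ideal.Icarr[OF ideal_max_ideal] by blast
    have "x = (x \<otimes> z) \<otimes> inv z" using u xc zc by (simp add: m_assoc)
    also have "x \<otimes> z = \<zero>" using z assms by (simp add: socle_def)
    finally show False using u assms by simp
  qed
qed

section \<open>Fibre products and connected sums\<close>

lemma residue_projection_max_ideal:
  assumes "residue_projection R k \<pi>"
  shows "r \<in> max_ideal R \<longleftrightarrow> r \<in> carrier R \<and> \<pi> r = \<zero>\<^bsub>k\<^esub>"
  using assms unfolding residue_projection_def a_kernel_def' by blast

locale residue_fibre_product =
  fixes R :: "('a, 'm) ring_scheme" and S :: "('b, 'n) ring_scheme" and k :: "('k, 'l) ring_scheme"
    and \<pi>\<^sub>R \<pi>\<^sub>S
  assumes \<pi>\<^sub>R: "residue_projection R k \<pi>\<^sub>R" and \<pi>\<^sub>S: "residue_projection S k \<pi>\<^sub>S"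
begin

sublocale R: local_ring R using \<pi>\<^sub>R by (simp add: residue_projection_def)
sublocale S: local_ring S using \<pi>\<^sub>S by (simp add: residue_projection_def)
sublocale k: field k using \<pi>\<^sub>R by (simp add: residue_projection_def)
sublocale \<pi>\<^sub>R: ring_hom_cring R k \<pi>\<^sub>R
  using \<pi>\<^sub>R R.is_cring k.is_cring
  by (simp add: residue_projection_def ring_hom_cring_def ring_hom_cring_axioms_def)
sublocale \<pi>\<^sub>S: ring_hom_cring S k \<pi>\<^sub>S
  using \<pi>\<^sub>S S.is_cring k.is_cring
  by (simp add: residue_projection_def ring_hom_cring_def ring_hom_cring_axioms_def)

abbreviation P where "P \<equiv> fibre_product R S \<pi>\<^sub>R \<pi>\<^sub>S"

lemma fibre_simps:
  "(r, s) \<in> carrier P \<longleftrightarrow> r \<in> carrier R \<and> s \<in> carrier S \<and> \<pi>\<^sub>R r = \<pi>\<^sub>S s"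
  "(r, s) \<otimes>\<^bsub>P\<^esub> (r', s') = (r \<otimes>\<^bsub>R\<^esub> r', s \<otimes>\<^bsub>S\<^esub> s')"
  "(r, s) \<oplus>\<^bsub>P\<^esub> (r', s') = (r \<oplus>\<^bsub>R\<^esub> r', s \<oplus>\<^bsub>S\<^esub> s')"
  "\<one>\<^bsub>P\<^esub> = (\<one>\<^bsub>R\<^esub>, \<one>\<^bsub>S\<^esub>)" "\<zero>\<^bsub>P\<^esub> = (\<zero>\<^bsub>R\<^esub>, \<zero>\<^bsub>S\<^esub>)"
  by (simp_all add: fibre_product_def RDirProd_def DirProd_def monoid.defs)

sublocale P: cring P
proof (rule cringI)
  show "abelian_group P"
  proof (rule abelian_groupI)
    show "\<exists>y\<in>carrier P. y \<oplus>\<^bsub>P\<^esub> x = \<zero>\<^bsub>P\<^esub>" if "x \<in> carrier P" for x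
    proof (cases x)
      case (Pair r s)
      have "(\<ominus>\<^bsub>R\<^esub> r, \<ominus>\<^bsub>S\<^esub> s) \<in> carrier P" "(\<ominus>\<^bsub>R\<^esub> r, \<ominus>\<^bsub>S\<^esub> s) \<oplus>\<^bsub>P\<^esub> x = \<zero>\<^bsub>P\<^esub>"
        using that by (simp_all add: Pair fibre_simps R.l_neg S.l_neg)
      then show ?thesis by blast
    qed
  qed (auto simp: fibre_simps R.a_ac S.a_ac)
  show "comm_monoid P"
    by (rule comm_monoidI) (auto simp: fibre_simps R.m_ac S.m_ac)
qed (auto simp: fibre_simps R.l_distr S.l_distr)

lemma fibre_minus:
  assumes "(r, s) \<in> carrier P"
  shows "\<ominus>\<^bsub>P\<^esub> (r, s) = (\<ominus>\<^bsub>R\<^esub> r, \<ominus>\<^bsub>S\<^esub> s)"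
  using assms by (intro P.minus_equality) (simp_all add: fibre_simps R.l_neg S.l_neg)

lemma fibre_inclusions:
  "r \<in> max_ideal R \<Longrightarrow> (r, \<zero>\<^bsub>S\<^esub>) \<in> carrier P" "s \<in> max_ideal S \<Longrightarrow> (\<zero>\<^bsub>R\<^esub>, s) \<in> carrier P"
  using residue_projection_max_ideal[OF \<pi>\<^sub>R] residue_projection_max_ideal[OF \<pi>\<^sub>S]
  by (auto simp: fibre_simps)

lemma fibre_unit:
  assumes rs: "(r, s) \<in> carrier P" and r: "r \<notin> max_ideal R"
  shows "(r, s) \<in> Units P"
proof -
  have c: "r \<in> carrier R" "s \<in> carrier S" "\<pi>\<^sub>R r = \<pi>\<^sub>S s" using rs by (simp_all add: fibre_simps)
  then have "s \<notin> max_ideal S"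
    using r residue_projection_max_ideal[OF \<pi>\<^sub>R] residue_projection_max_ideal[OF \<pi>\<^sub>S] by simp
  then have u: "r \<in> Units R" "s \<in> Units S"
    using r c R.max_ideal_if_nonunit S.max_ideal_if_nonunit by blast+
  let ?u = "inv\<^bsub>R\<^esub> r" and ?v = "inv\<^bsub>S\<^esub> s"
  have uv: "?u \<in> carrier R" "?v \<in> carrier S" using u by auto
  have "\<pi>\<^sub>R ?u \<otimes>\<^bsub>k\<^esub> \<pi>\<^sub>R r = \<one>\<^bsub>k\<^esub>" using u c(1) uv by (simp flip: \<pi>\<^sub>R.hom_mult)
  moreover have "\<pi>\<^sub>R r \<otimes>\<^bsub>k\<^esub> \<pi>\<^sub>S ?v = \<one>\<^bsub>k\<^esub>" unfolding c(3) using u c(2) uv by (simp flip: \<pi>\<^sub>S.hom_mult)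
  ultimately have "\<pi>\<^sub>R ?u = \<pi>\<^sub>S ?v" using k.inv_unique[of "\<pi>\<^sub>R ?u" "\<pi>\<^sub>R r" "\<pi>\<^sub>S ?v"] c uv by simp
  then have "(?u, ?v) \<in> carrier P" using uv by (simp add: fibre_simps)
  moreover have "(?u, ?v) \<otimes>\<^bsub>P\<^esub> (r, s) = \<one>\<^bsub>P\<^esub>" "(r, s) \<otimes>\<^bsub>P\<^esub> (?u, ?v) = \<one>\<^bsub>P\<^esub>"
    using u by (simp_all add: fibre_simps)
  ultimately show ?thesis using rs unfolding Units_def by blast
qed

text \<open>An element of the ideal has the form \<open>(r d, - s e)\<close> with \<open>r\<close> and \<open>s\<close> of the same residue class, and
  each component vanishes exactly if this class is zero. Hence the ideal meets \<open>R \<times> 0\<close> and \<open>0 \<times> S\<close>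
  trivially, so that both maximal ideals embed into the connected sum.\<close>
lemma connected_sum_kernel:
  assumes "gorenstein_artin_local_ring R" "gorenstein_artin_local_ring S"
    and d: "d \<in> max_ideal R" "socle R = PIdl\<^bsub>R\<^esub> d" and e: "e \<in> max_ideal S" "socle S = PIdl\<^bsub>S\<^esub> e"
    and xy: "(x, y) \<in> PIdl\<^bsub>P\<^esub> ((d, \<zero>\<^bsub>S\<^esub>) \<ominus>\<^bsub>P\<^esub> (\<zero>\<^bsub>R\<^esub>, e))"
  shows "x = \<zero>\<^bsub>R\<^esub> \<longleftrightarrow> y = \<zero>\<^bsub>S\<^esub>"
proof -
  interpret GR: gorenstein_artin_local_ring R by (rule assms)
  interpret GS: gorenstein_artin_local_ring S by (rule assms)
  have c: "d \<in> carrier R" "e \<in> carrier S"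
    using d e ideal.Icarr[OF R.ideal_max_ideal] ideal.Icarr[OF S.ideal_max_ideal] by blast+
  have "(d, \<zero>\<^bsub>S\<^esub>) \<ominus>\<^bsub>P\<^esub> (\<zero>\<^bsub>R\<^esub>, e) = (d, \<ominus>\<^bsub>S\<^esub> e)"
    using fibre_minus[OF fibre_inclusions(2)[OF e(1)]] c
    by (simp add: a_minus_def fibre_simps)
  then obtain p where p: "p \<in> carrier P" "(x, y) = p \<otimes>\<^bsub>P\<^esub> (d, \<ominus>\<^bsub>S\<^esub> e)"
    using xy unfolding cgenideal_def by auto
  obtain r s where "p = (r, s)" by (cases p)
  then have rs: "(r, s) \<in> carrier P" "(x, y) = (r, s) \<otimes>\<^bsub>P\<^esub> (d, \<ominus>\<^bsub>S\<^esub> e)" using p by simp_all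
  then have rc: "r \<in> carrier R" "s \<in> carrier S" "\<pi>\<^sub>R r = \<pi>\<^sub>S s"
    and xy: "x = r \<otimes>\<^bsub>R\<^esub> d" "y = \<ominus>\<^bsub>S\<^esub> (s \<otimes>\<^bsub>S\<^esub> e)"
    using c by (simp_all add: fibre_simps S.r_minus)
  have "x = \<zero>\<^bsub>R\<^esub> \<longleftrightarrow> r \<in> max_ideal R"
    using GR.socle_generator_annihilator[OF c(1) d(2) rc(1)] xy by simp
  also have "\<dots> \<longleftrightarrow> s \<in> max_ideal S"
    using residue_projection_max_ideal[OF \<pi>\<^sub>R] residue_projection_max_ideal[OF \<pi>\<^sub>S] rc by simp
  also have "\<dots> \<longleftrightarrow> s \<otimes>\<^bsub>S\<^esub> e = \<zero>\<^bsub>S\<^esub>"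
    using GS.socle_generator_annihilator[OF c(2) e(2) rc(2)] by simp
  also have "\<dots> \<longleftrightarrow> y = \<zero>\<^bsub>S\<^esub>"
    unfolding xy(2) using S.minus_minus[of "s \<otimes>\<^bsub>S\<^esub> e"] S.minus_zero rc(2) c(2) S.m_closed by metis
  finally show ?thesis .
qed

text \<open>Here \<open>A\<close> and \<open>B\<close> are the images of \<open>\<mm>\<^sub>R \<times> 0\<close> and \<open>0 \<times> \<mm>\<^sub>S\<close>. They consist of nonunits because each
  contains a nonzero element annihilated by the other, and they sum to the maximal ideal because an
  element of the fibre product outside \<open>\<mm>\<^sub>R \<times> \<mm>\<^sub>S\<close> is a unit. Injectivity on \<open>R \<times> 0\<close> and on \<open>0 \<times> S\<close>
  carries the nonzero products in \<open>\<mm>\<^sub>R\<close> and \<open>\<mm>\<^sub>S\<close> over to \<open>Q\<close>.\<close>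
lemma splitting_of_image:
  assumes Q: "local_ring Q" and h: "ring_hom_ring P Q h" and surj: "h ` carrier P = carrier Q"
    and inj: "\<And>x. (x, \<zero>\<^bsub>S\<^esub>) \<in> carrier P \<Longrightarrow> h (x, \<zero>\<^bsub>S\<^esub>) = \<zero>\<^bsub>Q\<^esub> \<Longrightarrow> x = \<zero>\<^bsub>R\<^esub>"
      "\<And>y. (\<zero>\<^bsub>R\<^esub>, y) \<in> carrier P \<Longrightarrow> h (\<zero>\<^bsub>R\<^esub>, y) = \<zero>\<^bsub>Q\<^esub> \<Longrightarrow> y = \<zero>\<^bsub>S\<^esub>"
    and R2: "loewy_length R \<ge> 2" and S2: "loewy_length S \<ge> 2"
  obtains A B where "A \<subseteq> max_ideal Q" "B \<subseteq> max_ideal Q"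
    "\<And>x. x \<in> max_ideal Q \<Longrightarrow> \<exists>a\<in>A. \<exists>b\<in>B. x = a \<oplus>\<^bsub>Q\<^esub> b"
    "\<And>a b. \<lbrakk>a \<in> A; b \<in> B\<rbrakk> \<Longrightarrow> a \<otimes>\<^bsub>Q\<^esub> b = \<zero>\<^bsub>Q\<^esub>"
    "\<exists>a\<in>A. \<exists>a'\<in>A. a \<otimes>\<^bsub>Q\<^esub> a' \<noteq> \<zero>\<^bsub>Q\<^esub>" "\<exists>b\<in>B. \<exists>b'\<in>B. b \<otimes>\<^bsub>Q\<^esub> b' \<noteq> \<zero>\<^bsub>Q\<^esub>"
proof -
  interpret Q: local_ring Q by (rule Q)
  interpret h: ring_hom_ring P Q h by (rule h)
  interpret mR: ideal "max_ideal R" R by (rule R.ideal_max_ideal)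
  interpret mS: ideal "max_ideal S" S by (rule S.ideal_max_ideal)
  let ?i = "\<lambda>r. h (r, \<zero>\<^bsub>S\<^esub>)" and ?j = "\<lambda>s. h (\<zero>\<^bsub>R\<^esub>, s)"
  define A where "A = ?i ` max_ideal R"
  define B where "B = ?j ` max_ideal S"
  note inc = fibre_inclusions
  have i_mult: "?i r \<otimes>\<^bsub>Q\<^esub> ?i r' = ?i (r \<otimes>\<^bsub>R\<^esub> r')" if "r \<in> max_ideal R" "r' \<in> max_ideal R" for r r'
    using h.hom_mult[OF inc(1)[OF that(1)] inc(1)[OF that(2)]]
    unfolding fibre_simps(2) S.l_null[OF S.zero_closed] by (rule sym)
  have j_mult: "?j s \<otimes>\<^bsub>Q\<^esub> ?j s' = ?j (s \<otimes>\<^bsub>S\<^esub> s')" if "s \<in> max_ideal S" "s' \<in> max_ideal S" for s s'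
    using h.hom_mult[OF inc(2)[OF that(1)] inc(2)[OF that(2)]]
    unfolding fibre_simps(2) R.l_null[OF R.zero_closed] by (rule sym)
  have orth: "a \<otimes>\<^bsub>Q\<^esub> b = \<zero>\<^bsub>Q\<^esub>" if "a \<in> A" "b \<in> B" for a b
  proof -
    obtain r s where rs: "r \<in> max_ideal R" "s \<in> max_ideal S" "a = ?i r" "b = ?j s"
      using \<open>a \<in> A\<close> \<open>b \<in> B\<close> unfolding A_def B_def by blast
    have "(r, \<zero>\<^bsub>S\<^esub>) \<otimes>\<^bsub>P\<^esub> (\<zero>\<^bsub>R\<^esub>, s) = \<zero>\<^bsub>P\<^esub>" using rs mR.Icarr mS.Icarr by (simp add: fibre_simps)
    then show ?thesis
      unfolding rs using h.hom_mult[OF inc(1)[OF rs(1)] inc(2)[OF rs(2)]] h.hom_zero by simp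
  qed
  have Ac: "A \<subseteq> carrier Q" and Bc: "B \<subseteq> carrier Q" unfolding A_def B_def using inc h.hom_closed by blast+
  obtain x x' where x: "x \<in> max_ideal R" "x' \<in> max_ideal R" "x \<otimes>\<^bsub>R\<^esub> x' \<noteq> \<zero>\<^bsub>R\<^esub>"
    using R.max_ideal_product_nonzero[OF R2] .
  obtain y y' where y: "y \<in> max_ideal S" "y' \<in> max_ideal S" "y \<otimes>\<^bsub>S\<^esub> y' \<noteq> \<zero>\<^bsub>S\<^esub>"
    using S.max_ideal_product_nonzero[OF S2] .
  have xx: "x \<otimes>\<^bsub>R\<^esub> x' \<in> max_ideal R" using x mR.I_l_closed mR.Icarr by blast
  have yy: "y \<otimes>\<^bsub>S\<^esub> y' \<in> max_ideal S" using y mS.I_l_closed mS.Icarr by blast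
  have xQ: "?i x \<otimes>\<^bsub>Q\<^esub> ?i x' \<noteq> \<zero>\<^bsub>Q\<^esub>" using inj(1)[OF inc(1)[OF xx]] x i_mult by auto
  have yQ: "?j y \<otimes>\<^bsub>Q\<^esub> ?j y' \<noteq> \<zero>\<^bsub>Q\<^esub>" using inj(2)[OF inc(2)[OF yy]] y j_mult by auto
  have a0: "\<exists>a\<in>A. a \<noteq> \<zero>\<^bsub>Q\<^esub>"
  proof (rule bexI)
    show "?i x \<in> A" unfolding A_def using x(1) by (rule imageI)
    show "?i x \<noteq> \<zero>\<^bsub>Q\<^esub>" using xQ Q.l_null[OF h.hom_closed[OF inc(1)[OF x(2)]]] by auto
  qed
  have b0: "\<exists>b\<in>B. b \<noteq> \<zero>\<^bsub>Q\<^esub>"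
  proof (rule bexI)
    show "?j y \<in> B" unfolding B_def using y(1) by (rule imageI)
    show "?j y \<noteq> \<zero>\<^bsub>Q\<^esub>" using yQ Q.l_null[OF h.hom_closed[OF inc(2)[OF y(2)]]] by auto
  qed
  have zero_divisor_in_max: "a \<in> max_ideal Q"
    if a: "a \<in> carrier Q" and b: "b \<in> carrier Q" "b \<noteq> \<zero>\<^bsub>Q\<^esub>" "a \<otimes>\<^bsub>Q\<^esub> b = \<zero>\<^bsub>Q\<^esub>" for a b
  proof (rule Q.max_ideal_if_nonunit[OF a])
    show "a \<notin> Units Q"
    proof
      assume u: "a \<in> Units Q"
      then have "b = inv\<^bsub>Q\<^esub> a \<otimes>\<^bsub>Q\<^esub> (a \<otimes>\<^bsub>Q\<^esub> b)" using a b(1) by (simp flip: Q.m_assoc)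
      then show False using b u by simp
    qed
  qed
  have Am: "A \<subseteq> max_ideal Q" using zero_divisor_in_max b0 orth Ac Bc by blast
  have Bm: "B \<subseteq> max_ideal Q"
  proof
    fix b assume b: "b \<in> B"
    obtain a where a: "a \<in> A" "a \<noteq> \<zero>\<^bsub>Q\<^esub>" using a0 by blast
    have "b \<otimes>\<^bsub>Q\<^esub> a = \<zero>\<^bsub>Q\<^esub>" using orth[OF a(1) b] Q.m_comm a b Ac Bc by (metis subsetD)
    then show "b \<in> max_ideal Q" using zero_divisor_in_max a b Ac Bc by blast
  qed
  have sum: "\<exists>a\<in>A. \<exists>b\<in>B. z = a \<oplus>\<^bsub>Q\<^esub> b" if z: "z \<in> max_ideal Q" for z
  proof -
    have zc: "z \<in> carrier Q" using z ideal.Icarr[OF Q.ideal_max_ideal] by blast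
    then obtain r s where rs: "(r, s) \<in> carrier P" "z = h (r, s)" using surj by (metis imageE surj_pair)
    have r: "r \<in> max_ideal R"
    proof (rule ccontr)
      assume "r \<notin> max_ideal R"
      then have u: "(r, s) \<in> Units P" using fibre_unit[OF rs(1)] by blast
      then have i: "inv\<^bsub>P\<^esub> (r, s) \<in> carrier P" by simp
      have "z \<otimes>\<^bsub>Q\<^esub> h (inv\<^bsub>P\<^esub> (r, s)) = h ((r, s) \<otimes>\<^bsub>P\<^esub> inv\<^bsub>P\<^esub> (r, s))"
        unfolding rs(2) using rs(1) i by simp
      also have "\<dots> = \<one>\<^bsub>Q\<^esub>" using u by simp
      finally have "\<one>\<^bsub>Q\<^esub> \<in> max_ideal Q"
        using ideal.I_r_closed[OF Q.ideal_max_ideal z h.hom_closed[OF i]] by simp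
      then show False using Q.one_notin_max_ideal by blast
    qed
    then have s: "s \<in> max_ideal S"
      using rs(1) residue_projection_max_ideal[OF \<pi>\<^sub>R] residue_projection_max_ideal[OF \<pi>\<^sub>S]
      by (simp add: fibre_simps)
    have "(r, s) = (r, \<zero>\<^bsub>S\<^esub>) \<oplus>\<^bsub>P\<^esub> (\<zero>\<^bsub>R\<^esub>, s)" using r s mR.Icarr mS.Icarr by (simp add: fibre_simps)
    then have "z = ?i r \<oplus>\<^bsub>Q\<^esub> ?j s" using rs(2) h.hom_add[OF inc(1)[OF r] inc(2)[OF s]] by simp
    then show ?thesis using r s unfolding A_def B_def by blast
  qed
  have "\<exists>a\<in>A. \<exists>a'\<in>A. a \<otimes>\<^bsub>Q\<^esub> a' \<noteq> \<zero>\<^bsub>Q\<^esub>" using xQ x unfolding A_def by blast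
  moreover have "\<exists>b\<in>B. \<exists>b'\<in>B. b \<otimes>\<^bsub>Q\<^esub> b' \<noteq> \<zero>\<^bsub>Q\<^esub>" using yQ y unfolding B_def by blast
  ultimately show ?thesis using that Am Bm sum orth by blast
qed

end

text \<open>The socle generators lie in the maximal ideals because these are nonzero, so that \<open>(d, 0)\<close> and
  \<open>(0, e)\<close> belong to the fibre product. The homomorphism onto \<open>Q\<close> is the quotient map followed by the
  inverse of the given isomorphism.\<close>
lemma connected_sum_splitting:
  assumes Q: "local_ring Q" and dec: "decomposes_as_connected_sum Q k R S"
  obtains A B where "A \<subseteq> max_ideal Q" "B \<subseteq> max_ideal Q"
    "\<And>x. x \<in> max_ideal Q \<Longrightarrow> \<exists>a\<in>A. \<exists>b\<in>B. x = a \<oplus>\<^bsub>Q\<^esub> b"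
    "\<And>a b. \<lbrakk>a \<in> A; b \<in> B\<rbrakk> \<Longrightarrow> a \<otimes>\<^bsub>Q\<^esub> b = \<zero>\<^bsub>Q\<^esub>"
    "\<exists>a\<in>A. \<exists>a'\<in>A. a \<otimes>\<^bsub>Q\<^esub> a' \<noteq> \<zero>\<^bsub>Q\<^esub>" "\<exists>b\<in>B. \<exists>b'\<in>B. b \<otimes>\<^bsub>Q\<^esub> b' \<noteq> \<zero>\<^bsub>Q\<^esub>"
proof -
  from dec obtain \<pi>\<^sub>R \<pi>\<^sub>S d e where RS: "gorenstein_artin_local_ring R" "gorenstein_artin_local_ring S"
      "loewy_length R \<ge> 2" "loewy_length S \<ge> 2"
    and \<pi>: "residue_projection R k \<pi>\<^sub>R" "residue_projection S k \<pi>\<^sub>S"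
    and d: "d \<in> carrier R" "socle R = PIdl\<^bsub>R\<^esub> d" and e: "e \<in> carrier S" "socle S = PIdl\<^bsub>S\<^esub> e"
    and iso: "Q \<simeq> connected_sum R S \<pi>\<^sub>R \<pi>\<^sub>S d e"
    unfolding decomposes_as_connected_sum_def by blast
  interpret residue_fibre_product R S k \<pi>\<^sub>R \<pi>\<^sub>S using \<pi> by unfold_locales
  interpret Q: local_ring Q by (rule Q)
  have dm: "d \<in> max_ideal R"
  proof -
    obtain x y where xy: "x \<in> max_ideal R" "y \<in> max_ideal R" "x \<otimes>\<^bsub>R\<^esub> y \<noteq> \<zero>\<^bsub>R\<^esub>"
      using R.max_ideal_product_nonzero[OF RS(3)] .
    then have "x \<noteq> \<zero>\<^bsub>R\<^esub>" using R.l_null ideal.Icarr[OF R.ideal_max_ideal] by blast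
    then show ?thesis using R.socle_subset_max_ideal[OF xy(1)] d R.cgenideal_self by blast
  qed
  have em: "e \<in> max_ideal S"
  proof -
    obtain x y where xy: "x \<in> max_ideal S" "y \<in> max_ideal S" "x \<otimes>\<^bsub>S\<^esub> y \<noteq> \<zero>\<^bsub>S\<^esub>"
      using S.max_ideal_product_nonzero[OF RS(4)] .
    then have "x \<noteq> \<zero>\<^bsub>S\<^esub>" using S.l_null ideal.Icarr[OF S.ideal_max_ideal] by blast
    then show ?thesis using S.socle_subset_max_ideal[OF xy(1)] e S.cgenideal_self by blast
  qed
  define K where "K = PIdl\<^bsub>P\<^esub> ((d, \<zero>\<^bsub>S\<^esub>) \<ominus>\<^bsub>P\<^esub> (\<zero>\<^bsub>R\<^esub>, e))"
  have "(d, \<zero>\<^bsub>S\<^esub>) \<ominus>\<^bsub>P\<^esub> (\<zero>\<^bsub>R\<^esub>, e) \<in> carrier P" using fibre_inclusions dm em by simp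
  then have K: "ideal K P" unfolding K_def by (rule P.cgenideal_ideal)
  interpret K: ideal K P by (rule K)
  have kernel: "x = \<zero>\<^bsub>R\<^esub> \<longleftrightarrow> y = \<zero>\<^bsub>S\<^esub>" if "(x, y) \<in> K" for x y
    using connected_sum_kernel[OF RS(1,2) dm d(2) em e(2)] that unfolding K_def by blast
  have "Q \<simeq> P Quot K" using iso unfolding connected_sum_def K_def Let_def .
  then have "P Quot K \<simeq> Q" using ring_iso_sym[OF Q.ring_axioms] by blast
  then obtain g where g: "g \<in> ring_hom (P Quot K) Q" "bij_betw g (carrier (P Quot K)) (carrier Q)"
    unfolding is_ring_iso_def ring_iso_def by blast
  define h where "h = g \<circ> (\<lambda>x. K +>\<^bsub>P\<^esub> x)"
  interpret G: ring_hom_ring "P Quot K" Q g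
    by (rule ring_hom_ringI2[OF K.quotient_is_ring Q.ring_axioms g(1)])
  have h: "ring_hom_ring P Q h"
    unfolding h_def by (rule ring_hom_ringI2[OF P.ring_axioms Q.ring_axioms ring_hom_trans[OF K.rcos_ring_hom g(1)]])
  have carr: "carrier (P Quot K) = (\<lambda>x. K +>\<^bsub>P\<^esub> x) ` carrier P"
    unfolding FactRing_def A_RCOSETS_def' by auto
  have surj: "h ` carrier P = carrier Q"
    using g(2) unfolding h_def bij_betw_def carr by (simp add: image_comp)
  have ker: "x \<in> K" if x: "x \<in> carrier P" "h x = \<zero>\<^bsub>Q\<^esub>" for x
  proof -
    have "g (K +>\<^bsub>P\<^esub> x) = g \<zero>\<^bsub>P Quot K\<^esub>" using x(2) G.hom_zero by (simp add: h_def)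
    moreover have "K +>\<^bsub>P\<^esub> x \<in> carrier (P Quot K)" using x(1) carr by blast
    ultimately have "K +>\<^bsub>P\<^esub> x = \<zero>\<^bsub>P Quot K\<^esub>"
      using g(2) G.R.zero_closed unfolding bij_betw_def by (blast dest: inj_onD)
    then have "K +>\<^bsub>P\<^esub> x = K" by (simp add: FactRing_def)
    then show ?thesis using K.a_rcos_self[OF x(1)] by simp
  qed
  have "x = \<zero>\<^bsub>R\<^esub>" if "(x, \<zero>\<^bsub>S\<^esub>) \<in> carrier P" "h (x, \<zero>\<^bsub>S\<^esub>) = \<zero>\<^bsub>Q\<^esub>" for x
    using kernel[OF ker[OF that]] by simp
  moreover have "y = \<zero>\<^bsub>S\<^esub>" if "(\<zero>\<^bsub>R\<^esub>, y) \<in> carrier P" "h (\<zero>\<^bsub>R\<^esub>, y) = \<zero>\<^bsub>Q\<^esub>" for y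
    using kernel[OF ker[OF that]] by simp
  ultimately show ?thesis
    by (rule splitting_of_image[OF Q h surj _ _ RS(3,4) that])
qed

section \<open>Indecomposability of compressed rings\<close>

theorem corollary3p11:
  fixes Q :: "('q, 'm) ring_scheme" and k :: "('k, 'n) ring_scheme" and \<pi> :: "'q \<Rightarrow> 'k"
  assumes "gorenstein_artin_local_ring Q"
    and "residue_projection Q k \<pi>"
    and "compressed Q"
    and "loewy_length Q \<ge> 4"
  shows "indecomposable_as_connected_sum TYPE('r) TYPE('s) Q k"
  unfolding indecomposable_as_connected_sum_def
proof
  assume "\<exists>(R :: 'r ring) (S :: 's ring). decomposes_as_connected_sum Q k R S"
  then obtain R :: "'r ring" and S :: "'s ring" where dec: "decomposes_as_connected_sum Q k R S"
    by blast
  interpret gorenstein_artin_local_ring Q by (rule assms)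
  from connected_sum_splitting[OF local_ring_axioms dec] obtain A B where
    AB: "A \<subseteq> max_ideal Q" "B \<subseteq> max_ideal Q"
      "\<And>x. x \<in> max_ideal Q \<Longrightarrow> \<exists>a\<in>A. \<exists>b\<in>B. x = a \<oplus>\<^bsub>Q\<^esub> b"
      "\<And>a b. \<lbrakk>a \<in> A; b \<in> B\<rbrakk> \<Longrightarrow> a \<otimes>\<^bsub>Q\<^esub> b = \<zero>\<^bsub>Q\<^esub>"
    and nz: "\<exists>a\<in>A. \<exists>a'\<in>A. a \<otimes>\<^bsub>Q\<^esub> a' \<noteq> \<zero>\<^bsub>Q\<^esub>" "\<exists>b\<in>B. \<exists>b'\<in>B. b \<otimes>\<^bsub>Q\<^esub> b' \<noteq> \<zero>\<^bsub>Q\<^esub>"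
    by blast
  have "hilbert_function Q 2 \<ge> (hilbert_function Q 1 + 1) choose 2"
    by (rule compressed_hilbert_function_2[OF assms(3,4)])
  from orthogonal_splitting_trivial[OF AB this] nz show False by blast
qed

end
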